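(* Let $(p_{ij} \colon X_j \to X_i)_{i \sqsubseteq j \in I}$ be a projective system of topological spaces, with canonical projective limit $X, (p_i)_{i \in I}$. If every $X_i$ is sober, and: 1. every $p_{ij}$ is a proper map (e.g., a projection), 2. or $I$ has a countable cofinal subset and each $X_i$ is locally compact, then $\mathcal P^{\mathrm q}_{\mathsf V} X$ (with the maps $\mathcal P^{\mathrm q}_{\mathsf V}\, p_i$) is a projective limit of $(\mathcal P^{\mathrm q}_{\mathsf V}\, p_{ij} \colon \mathcal P^{\mathrm q}_{\mathsf V} X_j \to \mathcal P^{\mathrm q}_{\mathsf V} X_i)_{i \sqsubseteq j \in I}$, and $\mathcal P^{\mathbf A}_{\mathsf V} X$ (with the maps $\mathcal P^{\mathbf A}_{\mathsf V}\, p_i$) is a projective limit of $(\mathcal P^{\mathbf A}_{\mathsf V}\, p_{ij} \colon \mathcal P^{\mathbf A}_{\mathsf V} X_j \to \mathcal P^{\mathbf A}_{\mathsf V} X_i)_{i \sqsubseteq j \in I}$.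
   Context: **Topology.** $\mathcal O X$ is the lattice of open subsets of $X$. The specialization preordering is: $x \leq y$ iff every open neighborhood of $x$ contains $y$; $\uparrow A$, $\downarrow A$ denote upward and downward closure, $cl(A)$ topological closure, $f[A]$ direct image. A subset is saturated iff it is upwards-closed. Compactness is the open cover property, with no separation axiom. A space is locally compact iff every point has a base of compact neighborhoods, and sober iff it is $T_0$ and every irreducible closed subset is the closure of a point. A continuous map $f \colon X \to Y$ is proper iff $\downarrow f[F]$ is closed for every closed $F \subseteq X$ and $f^{-1}(Q)$ is compact saturated for every compact saturated $Q \subseteq Y$. A projection is a continuous map $p \colon Y \to X$ for which there is a continuous map $e \colon X \to Y$ with $p \circ e = \mathrm{id}_X$ and $e \circ p \leq \mathrm{id}_Y$ pointwise in the specialization preordering; every projection is proper. **Projective systems.** A projective system $(p_{ij} \colon X_j \to X_i)_{i \sqsubseteq j \in I}$ consists of a directed preordered set $(I,\sqsubseteq)$, spaces $X_i$, and continuous maps $p_{ij}$ ($i \sqsubseteq j$) with $p_{ii} = \mathrm{id}$ and $p_{ij} \circ p_{jk} = p_{ik}$ for $i \sqsubseteq j \sqsubseteq k$. Its canonical projective limit is $X = \{\vec x \in \prod_{i} X_i \mid p_{ij}(x_j) = x_i \text{ for all } i \sqsubseteq j\}$ with the subspace topology of the product, $p_i$ being projection onto coordinate $i$. Saying that $Y$ with maps $(q_i)_{i\in I}$ is a projective limit of a projective system with canonical limit $Z$ means that the map $y \mapsto (q_i(y))_{i \in I}$ is a (well-defined) homeomorphism from $Y$ onto $Z$. **Functors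 (endofunctors on topological spaces).** - $\mathcal P^{\mathrm q}_{\mathsf V} X$: the set of quasi-lenses on $X$, i.e., pairs $(Q,C)$ of a compact saturated subset $Q$ and a closed subset $C$ of $X$ such that (1) $Q \cap C \neq \emptyset$; (2) $Q \subseteq \uparrow(Q \cap C)$; (3) for every open neighborhood $U$ of $Q$, $C \subseteq cl(U \cap C)$. Its topology is generated by the sets $\{(Q,C) \mid Q \subseteq U\}$ and $\{(Q,C) \mid C \cap U \neq \emptyset\}$, $U \in \mathcal O X$. A continuous map $f$ acts by $(Q,C) \mapsto (\uparrow f[Q], cl(f[C]))$. - $\mathcal P^{\mathbf A}_{\mathsf V} X$: the set of $\mathbf A$-valuations on $X$, where $\mathbf A = \{0,\mathbf M,1\}$ with $0<\mathbf M<1$. An $\mathbf A$-valuation is a Scott-continuous map $\alpha \colon \mathcal O X \to \mathbf A$ with $\alpha(\emptyset)=0$, $\alpha(X)=1$ and, for all open $U,V$: if $\alpha(U)=0$ then $\alpha(U \cup V)=\alpha(V)$; if $\alpha(V)=1$ then $\alpha(U\cap V)=\alpha(U)$. Its topology is generated by the sets $\{\alpha \mid \alpha(U)=1\}$ and $\{\alpha \mid \alpha(U)\neq 0\}$, $U \in \mathcal O X$. A continuous map $f \colon X \to Y$ acts by $\alpha \mapsto (V \mapsto \alpha(f^{-1}(V)))$. *)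

theory Defs
  imports "HOL-Analysis.Analysis"
begin

definition spec_le :: "'a topology \<Rightarrow> 'a \<Rightarrow> 'a \<Rightarrow> bool" where
  "spec_le X x y \<longleftrightarrow>
     x \<in> topspace X \<and> y \<in> topspace X \<and> (\<forall>U. openin X U \<and> x \<in> U \<longrightarrow> y \<in> U)"

definition up_closure :: "'a topology \<Rightarrow> 'a set \<Rightarrow> 'a set" where
  "up_closure X A = {y. \<exists>x\<in>A. spec_le X x y}"

definition down_closure :: "'a topology \<Rightarrow> 'a set \<Rightarrow> 'a set" where
  "down_closure X A = {x. \<exists>y\<in>A. spec_le X x y}"

definition saturatedin :: "'a topology \<Rightarrow> 'a set \<Rightarrow> bool" where
  "saturatedin X A \<longleftrightarrow>
     A \<subseteq> topspace X \<and> (\<forall>x y. x \<in> A \<and> spec_le X x y \<longrightarrow> y \<in> A)"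

definition compact_saturatedin :: "'a topology \<Rightarrow> 'a set \<Rightarrow> bool" where
  "compact_saturatedin X Q \<longleftrightarrow> compactin X Q \<and> saturatedin X Q"

definition irreducible_closedin :: "'a topology \<Rightarrow> 'a set \<Rightarrow> bool" where
  "irreducible_closedin X C \<longleftrightarrow>
     closedin X C \<and> C \<noteq> {} \<and>
     (\<forall>A B. closedin X A \<and> closedin X B \<and> C \<subseteq> A \<union> B \<longrightarrow> C \<subseteq> A \<or> C \<subseteq> B)"

definition sober_space :: "'a topology \<Rightarrow> bool" where
  "sober_space X \<longleftrightarrow>
     t0_space X \<and>
     (\<forall>C. irreducible_closedin X C \<longrightarrow> (\<exists>x\<in>topspace X. C = X closure_of {x}))"

text \<open>Without separation axioms, local compactness has to ask for a base of compact
  neighbourhoods at each point; the library's \<open>locally_compact_space\<close> only asks for one compact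
  neighbourhood.\<close>

definition base_locally_compact_space :: "'a topology \<Rightarrow> bool" where
  "base_locally_compact_space X \<longleftrightarrow> neighbourhood_base_of (compactin X) X"

text \<open>This is different from the library's \<open>proper_map\<close>, which asks for closed maps with compact
  fibres.\<close>

definition sat_proper_map :: "'a topology \<Rightarrow> 'b topology \<Rightarrow> ('a \<Rightarrow> 'b) \<Rightarrow> bool" where
  "sat_proper_map X Y f \<longleftrightarrow>
     continuous_map X Y f \<and>
     (\<forall>F. closedin X F \<longrightarrow> closedin Y (down_closure Y (f ` F))) \<and>
     (\<forall>Q. compact_saturatedin Y Q \<longrightarrow> compact_saturatedin X {x \<in> topspace X. f x \<in> Q})"

text \<open>The index set is the carrier \<open>I\<close>, and \<open>p i j\<close> is the bonding map from \<open>X j\<close> to \<open>X i\<close>.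
  Directed sets are nonempty.\<close>

locale projective_system =
  fixes I :: "'i set"
    and le :: "'i \<Rightarrow> 'i \<Rightarrow> bool"
    and X :: "'i \<Rightarrow> 'a topology"
    and p :: "'i \<Rightarrow> 'i \<Rightarrow> 'a \<Rightarrow> 'a"
  assumes index_refl: "reflp_on I le"
    and index_trans: "transp_on I le"
    and index_nonempty: "I \<noteq> {}"
    and index_directed: "\<lbrakk>i \<in> I; j \<in> I\<rbrakk> \<Longrightarrow> \<exists>k\<in>I. le i k \<and> le j k"
    and bonding_continuous: "\<lbrakk>i \<in> I; j \<in> I; le i j\<rbrakk> \<Longrightarrow> continuous_map (X j) (X i) (p i j)"
    and bonding_id: "\<lbrakk>i \<in> I; x \<in> topspace (X i)\<rbrakk> \<Longrightarrow> p i i x = x"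
    and bonding_comp: "\<lbrakk>i \<in> I; j \<in> I; k \<in> I; le i j; le j k; x \<in> topspace (X k)\<rbrakk>
      \<Longrightarrow> p i j (p j k x) = p i k x"

definition canonical_limit ::
  "'i set \<Rightarrow> ('i \<Rightarrow> 'i \<Rightarrow> bool) \<Rightarrow> ('i \<Rightarrow> 'a topology) \<Rightarrow> ('i \<Rightarrow> 'i \<Rightarrow> 'a \<Rightarrow> 'a)
     \<Rightarrow> ('i \<Rightarrow> 'a) topology" where
  "canonical_limit I le X p =
     subtopology (product_topology X I)
       {x \<in> (\<Pi>\<^sub>E i\<in>I. topspace (X i)). \<forall>i\<in>I. \<forall>j\<in>I. le i j \<longrightarrow> p i j (x j) = x i}"

definition is_projective_limit ::
  "'i set \<Rightarrow> ('i \<Rightarrow> 'i \<Rightarrow> bool) \<Rightarrow> ('i \<Rightarrow> 'a topology) \<Rightarrow> ('i \<Rightarrow> 'i \<Rightarrow> 'a \<Rightarrow> 'a)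
     \<Rightarrow> 'b topology \<Rightarrow> ('i \<Rightarrow> 'b \<Rightarrow> 'a) \<Rightarrow> bool" where
  "is_projective_limit I le X p Y q \<longleftrightarrow>
     projective_system I le X p \<and>
     homeomorphic_map Y (canonical_limit I le X p) (\<lambda>y. \<lambda>i\<in>I. q i y)"

definition has_countable_cofinal_subset :: "'i set \<Rightarrow> ('i \<Rightarrow> 'i \<Rightarrow> bool) \<Rightarrow> bool" where
  "has_countable_cofinal_subset I le \<longleftrightarrow>
     (\<exists>J. J \<subseteq> I \<and> countable J \<and> (\<forall>i\<in>I. \<exists>j\<in>J. le i j))"

definition quasi_lenses :: "'a topology \<Rightarrow> ('a set \<times> 'a set) set" where
  "quasi_lenses X = {(Q, C).
     compact_saturatedin X Q \<and> closedin X C \<and>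
     Q \<inter> C \<noteq> {} \<and>
     Q \<subseteq> up_closure X (Q \<inter> C) \<and>
     (\<forall>U. openin X U \<and> Q \<subseteq> U \<longrightarrow> C \<subseteq> X closure_of (U \<inter> C))}"

definition quasi_lens_space :: "'a topology \<Rightarrow> ('a set \<times> 'a set) topology" where
  "quasi_lens_space X = topology_generated_by
     ({{(Q, C) \<in> quasi_lenses X. Q \<subseteq> U} | U. openin X U} \<union>
      {{(Q, C) \<in> quasi_lenses X. C \<inter> U \<noteq> {}} | U. openin X U})"

text \<open>The action of the functor on a map to \<open>Y\<close>; it does not depend on the topology of the
  domain.\<close>

definition quasi_lens_map ::
  "'b topology \<Rightarrow> ('a \<Rightarrow> 'b) \<Rightarrow> 'a set \<times> 'a set \<Rightarrow> 'b set \<times> 'b set" where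
  "quasi_lens_map Y f = (\<lambda>(Q, C). (up_closure Y (f ` Q), Y closure_of (f ` C)))"

datatype aval = A0 | AM | A1

instantiation aval :: linorder
begin

fun less_eq_aval :: "aval \<Rightarrow> aval \<Rightarrow> bool" where
  "A0 \<le> b \<longleftrightarrow> True"
| "AM \<le> b \<longleftrightarrow> b \<noteq> A0"
| "A1 \<le> b \<longleftrightarrow> b = A1"

definition less_aval :: "aval \<Rightarrow> aval \<Rightarrow> bool" where
  "a < b \<longleftrightarrow> a \<le> b \<and> \<not> b \<le> (a :: aval)"

instance
proof
  fix a b c :: aval
  show "a < b \<longleftrightarrow> a \<le> b \<and> \<not> b \<le> a" by (simp add: less_aval_def)
  show "a \<le> a" by (cases a) auto
  show "a \<le> b \<Longrightarrow> b \<le> c \<Longrightarrow> a \<le> c" by (cases a; cases b; cases c) auto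
  show "a \<le> b \<Longrightarrow> b \<le> a \<Longrightarrow> a = b" by (cases a; cases b) auto
  show "a \<le> b \<or> b \<le> a" by (cases a; cases b) auto
qed

end

lemma finite_aval_set [simp]: "finite (S :: aval set)"
proof (rule finite_subset)
  show "S \<subseteq> {A0, AM, A1}" using aval.exhaust by auto
qed simp

instantiation aval :: complete_linorder
begin

definition bot_aval :: aval where "bot_aval = A0"
definition top_aval :: aval where "top_aval = A1"
definition inf_aval :: "aval \<Rightarrow> aval \<Rightarrow> aval" where "inf_aval = min"
definition sup_aval :: "aval \<Rightarrow> aval \<Rightarrow> aval" where "sup_aval = max"
definition Inf_aval :: "aval set \<Rightarrow> aval" where "Inf_aval S = Min (insert A1 S)"
definition Sup_aval :: "aval set \<Rightarrow> aval" where "Sup_aval S = Max (insert A0 S)"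

instance
proof
  have top: "z \<le> A1" for z :: aval by (cases z) auto
  fix x y z :: aval and S :: "aval set"
  show "inf x y \<le> x" "inf x y \<le> y" by (auto simp: inf_aval_def)
  show "x \<le> y \<Longrightarrow> x \<le> z \<Longrightarrow> x \<le> inf y z" by (auto simp: inf_aval_def)
  show "x \<le> sup x y" "y \<le> sup x y" by (auto simp: sup_aval_def)
  show "y \<le> x \<Longrightarrow> z \<le> x \<Longrightarrow> sup y z \<le> x" by (auto simp: sup_aval_def)
  show "x \<in> S \<Longrightarrow> Inf S \<le> x" by (simp add: Inf_aval_def)
  show "(\<And>x. x \<in> S \<Longrightarrow> z \<le> x) \<Longrightarrow> z \<le> Inf S" by (simp add: Inf_aval_def top)
  show "x \<in> S \<Longrightarrow> x \<le> Sup S" by (simp add: Sup_aval_def)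
  show "(\<And>x. x \<in> S \<Longrightarrow> x \<le> z) \<Longrightarrow> Sup S \<le> z" by (simp add: Sup_aval_def)
  show "Inf {} = (top :: aval)" by (simp add: Inf_aval_def top_aval_def)
  show "Sup {} = (bot :: aval)" by (simp add: Sup_aval_def bot_aval_def)
qed

end

definition directed_family :: "'a set set \<Rightarrow> bool" where
  "directed_family D \<longleftrightarrow> D \<noteq> {} \<and> (\<forall>U\<in>D. \<forall>V\<in>D. \<exists>W\<in>D. U \<subseteq> W \<and> V \<subseteq> W)"

definition scott_continuous_on_opens :: "'a topology \<Rightarrow> ('a set \<Rightarrow> aval) \<Rightarrow> bool" where
  "scott_continuous_on_opens X \<alpha> \<longleftrightarrow>
     (\<forall>U V. openin X U \<and> openin X V \<and> U \<subseteq> V \<longrightarrow> \<alpha> U \<le> \<alpha> V) \<and>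
     (\<forall>D. directed_family D \<and> (\<forall>U\<in>D. openin X U) \<longrightarrow> \<alpha> (\<Union>D) = (SUP U\<in>D. \<alpha> U))"

text \<open>A map defined on the open subsets only is encoded as a function that is extensional, that
  is, \<open>undefined\<close> on all other sets.\<close>

definition A_valuations :: "'a topology \<Rightarrow> ('a set \<Rightarrow> aval) set" where
  "A_valuations X = {\<alpha> \<in> extensional {U. openin X U}.
     scott_continuous_on_opens X \<alpha> \<and>
     \<alpha> {} = A0 \<and> \<alpha> (topspace X) = A1 \<and>
     (\<forall>U V. openin X U \<and> openin X V \<and> \<alpha> U = A0 \<longrightarrow> \<alpha> (U \<union> V) = \<alpha> V) \<and>
     (\<forall>U V. openin X U \<and> openin X V \<and> \<alpha> V = A1 \<longrightarrow> \<alpha> (U \<inter> V) = \<alpha> U)}"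

definition A_valuation_space :: "'a topology \<Rightarrow> ('a set \<Rightarrow> aval) topology" where
  "A_valuation_space X = topology_generated_by
     ({{\<alpha> \<in> A_valuations X. \<alpha> U = A1} | U. openin X U} \<union>
      {{\<alpha> \<in> A_valuations X. \<alpha> U \<noteq> A0} | U. openin X U})"

definition A_valuation_map ::
  "'a topology \<Rightarrow> 'b topology \<Rightarrow> ('a \<Rightarrow> 'b) \<Rightarrow> ('a set \<Rightarrow> aval) \<Rightarrow> ('b set \<Rightarrow> aval)" where
  "A_valuation_map X Y f \<alpha> = (\<lambda>V \<in> {V. openin Y V}. \<alpha> {x \<in> topspace X. f x \<in> V})"

end

theory Submission
  imports Defs
begin

text \<open>On a sober space a quasi-lens \<open>(Q, C)\<close> and an A-valuation carry the same information: the open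
  sets of value \<open>A1\<close> are the neighbourhoods of \<open>Q\<close>, and those of value different from \<open>A0\<close> are the
  ones that meet \<open>C\<close>. The correspondence is a natural homeomorphism
  (\<open>homeomorphic_map_lens_valuation\<close>, \<open>quasi_lens_map_natural\<close>), and limits of sober spaces are sober
  (\<open>sober_limit\<close>), so it suffices to treat A-valuations and to transport the result
  (\<open>is_projective_limit_transport\<close>).

  Every open set of the limit is a directed union of preimages of open sets of the \<open>X i\<close>. By Scott
  continuity, the comparison map for A-valuations is therefore injective and its domain carries the
  initial topology. What remains is surjectivity: a compatible family of valuations must come from a
  valuation on the limit.

  The open sets of value \<open>A1\<close> form Scott-open filters, and the supports \<open>C i\<close> are closed sets. Let \<open>Q\<close>
  be the set of threads that lie in all members of the filters, and let \<open>K\<close> be the set of threads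
  through the \<open>C i\<close>. One has to show that \<open>Q\<close> and \<open>K\<close> are large enough to recover the valuations.
  Both statements ask for threads that lie in given filters and avoid given open sets, and
  \<open>thread_avoiding\<close> constructs such threads for all sober spaces with a maximality argument. For \<open>Q\<close>
  this is enough. For \<open>K\<close> one needs in addition Scott-open filters whose members meet the \<open>C i\<close> and
  force the thread into a given open set \<open>U\<close> that meets \<open>C i\<close>. If the bonding maps are proper, such
  filters come from the compact sets of points of \<open>C j\<close> that lie above a fixed point of \<open>C i\<close> in
  \<open>U\<close> (\<open>closed_system_thread_proper\<close>). If the \<open>X i\<close> are locally compact and the index set is
  countably cofinal, they come from a sequence of compact neighbourhoods
  (\<open>closed_system_thread_locally_compact\<close>).\<close>

section \<open>Directed covers and Scott-open filters of open sets\<close>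

lemma directed_family_finite_bound:
  assumes "directed_family D" "finite E" "E \<subseteq> D"
  shows "\<exists>W\<in>D. \<Union>E \<subseteq> W"
  using assms(2,3)
proof (induction E rule: finite_induct)
  case empty
  then show ?case using assms(1) by (auto simp: directed_family_def)
next
  case (insert U E)
  then obtain W where "W \<in> D" "\<Union>E \<subseteq> W" "U \<in> D" by auto
  then obtain W' where "W' \<in> D" "U \<subseteq> W'" "W \<subseteq> W'"
    using assms(1) unfolding directed_family_def by meson
  then show ?case using \<open>\<Union>E \<subseteq> W\<close> by (intro bexI[of _ W']) auto
qed

lemma directed_family_image:
  assumes D: "directed_family D" and mono: "\<And>U V. U \<subseteq> V \<Longrightarrow> g U \<subseteq> g V"
  shows "directed_family (g ` D)"
  unfolding directed_family_def
proof (intro conjI ballI)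
  show "g ` D \<noteq> {}" using D unfolding directed_family_def by blast
  fix A B assume "A \<in> g ` D" "B \<in> g ` D"
  then obtain U V where UV: "U \<in> D" "V \<in> D" "A = g U" "B = g V" by blast
  then obtain W where W: "W \<in> D" "U \<subseteq> W" "V \<subseteq> W" using D unfolding directed_family_def by meson
  then show "\<exists>C\<in>g ` D. A \<subseteq> C \<and> B \<subseteq> C" using UV mono by (intro bexI[of _ "g W"]) simp_all
qed

lemma compactin_iff_directed_cover:
  "compactin T K \<longleftrightarrow> K \<subseteq> topspace T \<and>
     (\<forall>D. directed_family D \<and> (\<forall>U\<in>D. openin T U) \<and> K \<subseteq> \<Union>D \<longrightarrow> (\<exists>U\<in>D. K \<subseteq> U))"
    (is "_ \<longleftrightarrow> _ \<and> ?dir")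
proof (intro iffI conjI allI impI)
  assume K: "compactin T K"
  then show "K \<subseteq> topspace T" by (rule compactin_subset_topspace)
  fix D assume D: "directed_family D \<and> (\<forall>U\<in>D. openin T U) \<and> K \<subseteq> \<Union>D"
  then obtain E where "finite E" "E \<subseteq> D" "K \<subseteq> \<Union>E"
    using K unfolding compactin_def by meson
  then show "\<exists>U\<in>D. K \<subseteq> U" using D directed_family_finite_bound by (meson subset_trans)
next
  assume a: "K \<subseteq> topspace T \<and> ?dir"
  show "compactin T K"
    unfolding compactin_def
  proof (intro conjI allI impI)
    show "K \<subseteq> topspace T" using a by blast
    fix \<U> assume \<U>: "Ball \<U> (openin T) \<and> K \<subseteq> \<Union>\<U>"
    let ?D = "{\<Union>E | E. finite E \<and> E \<subseteq> \<U>}"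
    have "directed_family ?D"
      unfolding directed_family_def
    proof (intro conjI ballI)
      show "?D \<noteq> {}" by blast
      fix U V assume "U \<in> ?D" "V \<in> ?D"
      then obtain E F where "finite E" "E \<subseteq> \<U>" "U = \<Union>E" "finite F" "F \<subseteq> \<U>" "V = \<Union>F"
        by blast
      then have "finite (E \<union> F)" "E \<union> F \<subseteq> \<U>" "U \<subseteq> \<Union>(E \<union> F)" "V \<subseteq> \<Union>(E \<union> F)"
        by auto
      then show "\<exists>W\<in>?D. U \<subseteq> W \<and> V \<subseteq> W" by blast
    qed
    moreover have "\<forall>U\<in>?D. openin T U" using \<U> by auto
    moreover have "K \<subseteq> \<Union>?D"
    proof
      fix x assume "x \<in> K"
      then obtain U where "U \<in> \<U>" "x \<in> U" using \<U> by blast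
      then have "finite {U}" "{U} \<subseteq> \<U>" "x \<in> \<Union>{U}" by auto
      then show "x \<in> \<Union>?D" by blast
    qed
    ultimately obtain U where "U \<in> ?D" "K \<subseteq> U" using a by meson
    then show "\<exists>\<F>. finite \<F> \<and> \<F> \<subseteq> \<U> \<and> K \<subseteq> \<Union>\<F>" by blast
  qed
qed

text \<open>The empty family is included, so that a family of filters can be nontrivial on a cofinal part
  of the index set only.\<close>

definition scott_open_filterin :: "'a topology \<Rightarrow> 'a set set \<Rightarrow> bool" where
  "scott_open_filterin T F \<longleftrightarrow>
     (\<forall>U\<in>F. openin T U) \<and>
     (\<forall>U V. U \<in> F \<and> openin T V \<and> U \<subseteq> V \<longrightarrow> V \<in> F) \<and>
     (\<forall>U\<in>F. \<forall>V\<in>F. U \<inter> V \<in> F) \<and>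
     (\<forall>D. directed_family D \<and> (\<forall>U\<in>D. openin T U) \<and> \<Union>D \<in> F \<longrightarrow> (\<exists>U\<in>D. U \<in> F))"

lemma scott_open_filterinD:
  assumes "scott_open_filterin T F"
  shows "U \<in> F \<Longrightarrow> openin T U"
    and "U \<in> F \<Longrightarrow> openin T V \<Longrightarrow> U \<subseteq> V \<Longrightarrow> V \<in> F"
    and "U \<in> F \<Longrightarrow> V \<in> F \<Longrightarrow> U \<inter> V \<in> F"
    and "directed_family D \<Longrightarrow> (\<And>U. U \<in> D \<Longrightarrow> openin T U) \<Longrightarrow> \<Union>D \<in> F \<Longrightarrow> \<exists>U\<in>D. U \<in> F"
  using assms unfolding scott_open_filterin_def by meson+

lemma scott_open_filterin_empty: "scott_open_filterin T {}"
  by (simp add: scott_open_filterin_def)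

lemma scott_open_filterin_compact:
  assumes "compactin T K"
  shows "scott_open_filterin T {U. openin T U \<and> K \<subseteq> U}"
  unfolding scott_open_filterin_def using assms[unfolded compactin_iff_directed_cover]
  by (intro conjI ballI allI impI) auto

lemma subset_up_closure: "A \<subseteq> topspace T \<Longrightarrow> A \<subseteq> up_closure T A"
  unfolding up_closure_def spec_le_def by blast

lemma up_closure_subset_open_iff:
  assumes "openin T U" "A \<subseteq> topspace T"
  shows "up_closure T A \<subseteq> U \<longleftrightarrow> A \<subseteq> U"
proof
  show "A \<subseteq> U" if "up_closure T A \<subseteq> U" using that subset_up_closure[OF assms(2)] by blast
  show "up_closure T A \<subseteq> U" if "A \<subseteq> U"
    using that assms(1) unfolding up_closure_def spec_le_def by blast
qed

lemma compact_saturatedin_up_closure: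
  assumes K: "compactin T K"
  shows "compact_saturatedin T (up_closure T K)"
proof -
  have Ksub: "K \<subseteq> topspace T" by (rule compactin_subset_topspace[OF K])
  have "compactin T (up_closure T K)"
    unfolding compactin_iff_directed_cover
  proof (intro conjI allI impI)
    show "up_closure T K \<subseteq> topspace T" unfolding up_closure_def spec_le_def by blast
    fix D assume D: "directed_family D \<and> (\<forall>U\<in>D. openin T U) \<and> up_closure T K \<subseteq> \<Union>D"
    then have "K \<subseteq> \<Union>D" using subset_up_closure[OF Ksub] by blast
    then obtain U where "U \<in> D" "K \<subseteq> U"
      using K D unfolding compactin_iff_directed_cover by meson
    then show "\<exists>U\<in>D. up_closure T K \<subseteq> U" using up_closure_subset_open_iff Ksub D by blast
  qed
  moreover have "saturatedin T (up_closure T K)"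
    unfolding saturatedin_def up_closure_def spec_le_def by blast
  ultimately show ?thesis unfolding compact_saturatedin_def by blast
qed

text \<open>The complement of a prime open set is irreducible, and the point is a generic point of it.\<close>

lemma sober_prime_open_generic:
  assumes sober: "sober_space T" and W: "openin T W" "W \<noteq> topspace T"
    and prime: "\<And>A B. openin T A \<Longrightarrow> openin T B \<Longrightarrow> A \<inter> B \<subseteq> W \<Longrightarrow> A \<subseteq> W \<or> B \<subseteq> W"
  shows "\<exists>x\<in>topspace T. \<forall>U. openin T U \<longrightarrow> (x \<in> U \<longleftrightarrow> \<not> U \<subseteq> W)"
proof -
  have sub: "W \<subseteq> topspace T" using W(1) openin_subset by blast
  have "irreducible_closedin T (topspace T - W)"
    unfolding irreducible_closedin_def
  proof (intro conjI allI impI)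
    show "closedin T (topspace T - W)" using W(1) by blast
    show "topspace T - W \<noteq> {}" using W(2) sub by blast
    fix A B assume AB: "closedin T A \<and> closedin T B \<and> topspace T - W \<subseteq> A \<union> B"
    have "topspace T - A \<subseteq> W \<or> topspace T - B \<subseteq> W"
      by (rule prime) (use AB in auto)
    then show "topspace T - W \<subseteq> A \<or> topspace T - W \<subseteq> B" by blast
  qed
  then obtain x where x: "x \<in> topspace T" "topspace T - W = T closure_of {x}"
    using sober unfolding sober_space_def by blast
  have "x \<in> U \<longleftrightarrow> \<not> U \<subseteq> W" if "openin T U" for U
    using openin_Int_closure_of_eq_empty[OF that, of "{x}"] openin_subset[OF that] x(2) sub
    by blast
  then show ?thesis using x(1) by blast
qed

section \<open>Threads of a projective system of sober spaces\<close>

context projective_system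
begin

abbreviation limit :: "('i \<Rightarrow> 'a) topology" where
  "limit \<equiv> canonical_limit I le X p"

abbreviation pull :: "'i \<Rightarrow> 'i \<Rightarrow> 'a set \<Rightarrow> 'a set" where
  "pull i j U \<equiv> {x \<in> topspace (X j). p i j x \<in> U}"

abbreviation cylinder :: "'i \<Rightarrow> 'a set \<Rightarrow> ('i \<Rightarrow> 'a) set" where
  "cylinder i U \<equiv> {x \<in> topspace limit. x i \<in> U}"

lemma le_refl: "i \<in> I \<Longrightarrow> le i i"
  using index_refl by (rule reflp_onD)

lemma le_trans: "\<lbrakk>i \<in> I; j \<in> I; k \<in> I; le i j; le j k\<rbrakk> \<Longrightarrow> le i k"
  using index_trans by (rule transp_onD)

lemma bonding_in: "\<lbrakk>i \<in> I; j \<in> I; le i j; x \<in> topspace (X j)\<rbrakk> \<Longrightarrow> p i j x \<in> topspace (X i)"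
  by (rule funcset_mem[OF continuous_map_funspace[OF bonding_continuous]])

lemma pull_open: "\<lbrakk>i \<in> I; j \<in> I; le i j; openin (X i) U\<rbrakk> \<Longrightarrow> openin (X j) (pull i j U)"
  by (rule openin_continuous_map_preimage[OF bonding_continuous])

lemma pull_pull:
  "\<lbrakk>i \<in> I; j \<in> I; k \<in> I; le i j; le j k\<rbrakk> \<Longrightarrow> pull j k (pull i j U) = pull i k U"
  using bonding_comp bonding_in by auto

lemma pull_refl: "i \<in> I \<Longrightarrow> U \<subseteq> topspace (X i) \<Longrightarrow> pull i i U = U"
  using bonding_id by auto

lemma topspace_limit:
  "topspace limit =
     {x \<in> (\<Pi>\<^sub>E i\<in>I. topspace (X i)). \<forall>i\<in>I. \<forall>j\<in>I. le i j \<longrightarrow> p i j (x j) = x i}"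
  unfolding canonical_limit_def by auto

lemma limit_coord: "x \<in> topspace limit \<Longrightarrow> i \<in> I \<Longrightarrow> x i \<in> topspace (X i)"
  unfolding topspace_limit by auto

lemma limit_compat: "x \<in> topspace limit \<Longrightarrow> i \<in> I \<Longrightarrow> j \<in> I \<Longrightarrow> le i j \<Longrightarrow> p i j (x j) = x i"
  unfolding topspace_limit by auto

lemma limit_eqI:
  assumes "x \<in> topspace limit" "y \<in> topspace limit" "\<And>i. i \<in> I \<Longrightarrow> x i = y i"
  shows "x = y"
proof (rule PiE_ext)
  show "x \<in> (\<Pi>\<^sub>E i\<in>I. topspace (X i))" "y \<in> (\<Pi>\<^sub>E i\<in>I. topspace (X i))"
    using assms(1,2) unfolding topspace_limit by auto
qed (use assms(3) in auto)

lemma cylinder_pull: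
  "\<lbrakk>i \<in> I; j \<in> I; le i j\<rbrakk> \<Longrightarrow> cylinder j (pull i j U) = cylinder i U"
  using limit_coord limit_compat by auto

lemma continuous_map_coord: "i \<in> I \<Longrightarrow> continuous_map limit (X i) (\<lambda>x. x i)"
  unfolding canonical_limit_def
  by (intro continuous_map_from_subtopology continuous_map_product_projection)

lemma cylinder_open: "i \<in> I \<Longrightarrow> openin (X i) U \<Longrightarrow> openin limit (cylinder i U)"
  by (rule openin_continuous_map_preimage[OF continuous_map_coord])

lemma finite_index_bound:
  assumes "finite J" "J \<subseteq> I"
  shows "\<exists>k\<in>I. \<forall>i\<in>J. le i k"
  using assms
proof (induction J rule: finite_induct)
  case empty
  then show ?case using index_nonempty by blast
next
  case (insert j J)
  then obtain k where k: "k \<in> I" "\<forall>i\<in>J. le i k" by auto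
  with insert.prems obtain l where "l \<in> I" "le j l" "le k l" using index_directed by blast
  then show ?case using k insert.prems le_trans by (intro bexI[of _ l]) blast+
qed

text \<open>A basic open box restricts finitely many coordinates; directedness pulls all of these
  restrictions back to one coordinate.\<close>

lemma cylinder_base:
  assumes W: "openin limit W" "x \<in> W"
  obtains i U where "i \<in> I" "openin (X i) U" "x i \<in> U" "cylinder i U \<subseteq> W"
proof -
  let ?Z = "{x \<in> (\<Pi>\<^sub>E i\<in>I. topspace (X i)). \<forall>i\<in>I. \<forall>j\<in>I. le i j \<longrightarrow> p i j (x j) = x i}"
  from W obtain S where S: "openin (product_topology X I) S" "W = S \<inter> ?Z"
    unfolding canonical_limit_def openin_subtopology by blast
  then have "x \<in> S" using W(2) by blast
  from bspec[OF S(1)[unfolded openin_product_topology_alt] this]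
  obtain B where "finite {i \<in> I. B i \<noteq> topspace (X i)} \<and> (\<forall>i\<in>I. openin (X i) (B i)) \<and>
      x \<in> Pi\<^sub>E I B \<and> Pi\<^sub>E I B \<subseteq> S"
    by (rule exE)
  then have B: "finite {i \<in> I. B i \<noteq> topspace (X i)}" "\<forall>i\<in>I. openin (X i) (B i)"
      "x \<in> Pi\<^sub>E I B" "Pi\<^sub>E I B \<subseteq> S"
    by simp_all
  let ?J = "{i \<in> I. B i \<noteq> topspace (X i)}"
  obtain k where k: "k \<in> I" "\<forall>i\<in>?J. le i k"
    using finite_index_bound[OF B(1)] by auto
  have xL: "x \<in> topspace limit" using W openin_subset by blast
  let ?U = "topspace (X k) \<inter> (\<Inter>i\<in>?J. pull i k (B i))"
  have "openin (X k) ?U"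
  proof (cases "?J = {}")
    case True
    then show ?thesis by (simp only: True) simp
  next
    case False
    have "openin (X k) (\<Inter>i\<in>?J. pull i k (B i))"
      by (rule openin_INT2) (use B k pull_open False in auto)
    then show ?thesis by blast
  qed
  moreover have "x k \<in> ?U"
    using xL k B(3) limit_coord limit_compat by (auto simp: PiE_iff)
  moreover have "cylinder k ?U \<subseteq> W"
  proof
    fix y assume y: "y \<in> cylinder k ?U"
    then have yL: "y \<in> topspace limit" by blast
    have "y i \<in> B i" if "i \<in> I" for i
    proof (cases "i \<in> ?J")
      case True
      then have "p i k (y k) \<in> B i" using y by blast
      then show ?thesis using limit_compat[OF yL that k(1)] k(2) True by auto
    next
      case False
      then show ?thesis using limit_coord[OF yL that] that by blast
    qed
    then have "y \<in> Pi\<^sub>E I B" using yL unfolding topspace_limit by (auto simp: PiE_iff)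
    then show "y \<in> W" using S(2) B(4) yL unfolding topspace_limit by blast
  qed
  ultimately show ?thesis using that k(1) by blast
qed

text \<open>The families below present the open sets of the point-free limit. A component may be larger
  than the pullbacks of earlier ones, so that pointwise unions of such families are again such
  families.\<close>

definition coherent_opens :: "('i \<Rightarrow> 'a set) \<Rightarrow> bool" where
  "coherent_opens W \<longleftrightarrow>
     (\<forall>i\<in>I. openin (X i) (W i)) \<and>
     (\<forall>i\<in>I. \<forall>j\<in>I. le i j \<longrightarrow> pull i j (W i) \<subseteq> W j)"

definition filter_system :: "('i \<Rightarrow> 'a set set) \<Rightarrow> bool" where
  "filter_system F \<longleftrightarrow>
     (\<forall>i\<in>I. scott_open_filterin (X i) (F i)) \<and>
     (\<forall>i\<in>I. \<forall>j\<in>I. \<forall>U. le i j \<and> U \<in> F i \<longrightarrow> pull i j U \<in> F j) \<and>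
     (\<exists>i\<in>I. F i \<noteq> {})"

lemma coherent_opensD:
  assumes "coherent_opens W"
  shows "i \<in> I \<Longrightarrow> openin (X i) (W i)"
    and "\<lbrakk>i \<in> I; j \<in> I; le i j\<rbrakk> \<Longrightarrow> pull i j (W i) \<subseteq> W j"
  using assms unfolding coherent_opens_def by meson+

lemma filter_systemD:
  assumes "filter_system F"
  shows "i \<in> I \<Longrightarrow> scott_open_filterin (X i) (F i)"
    and "\<lbrakk>i \<in> I; j \<in> I; le i j; U \<in> F i\<rbrakk> \<Longrightarrow> pull i j U \<in> F j"
    and "\<exists>i\<in>I. F i \<noteq> {}"
  using assms unfolding filter_system_def by meson+

lemma coherent_opens_union:
  assumes A: "coherent_opens A" and B: "coherent_opens B"
  shows "coherent_opens (\<lambda>i. A i \<union> B i)"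
  unfolding coherent_opens_def
proof (intro conjI ballI impI)
  fix i j assume ij: "i \<in> I" "j \<in> I" "le i j"
  show "pull i j (A i \<union> B i) \<subseteq> A j \<union> B j"
    using coherent_opensD(2)[OF A ij] coherent_opensD(2)[OF B ij] by blast
qed (use coherent_opensD(1)[OF A] coherent_opensD(1)[OF B] in blast)

lemma coherent_opens_from:
  assumes i: "i \<in> I" and U: "openin (X i) U"
  shows "coherent_opens (\<lambda>j. if le i j then pull i j U else {})"
  unfolding coherent_opens_def
proof (intro conjI ballI impI)
  fix j k assume jk: "j \<in> I" "k \<in> I" "le j k"
  show "pull j k (if le i j then pull i j U else {}) \<subseteq> (if le i k then pull i k U else {})"
    using pull_pull[OF i jk(1,2) _ jk(3), of U] le_trans[OF i jk(1,2) _ jk(3)] by auto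
qed (use pull_open[OF i _ _ U] in auto)

text \<open>The union of this family is the open set of the limit that the coherent family presents.\<close>

lemma directed_family_cylinders:
  assumes V: "coherent_opens V"
  shows "directed_family ((\<lambda>i. cylinder i (V i)) ` I)"
  unfolding directed_family_def
proof (intro conjI ballI)
  let ?D = "(\<lambda>i. cylinder i (V i)) ` I"
  show "?D \<noteq> {}" using index_nonempty by blast
  have mono: "cylinder i (V i) \<subseteq> cylinder j (V j)" if "i \<in> I" "j \<in> I" "le i j" for i j
    using cylinder_pull[OF that, of "V i"] coherent_opensD(2)[OF V that] by blast
  fix A B assume "A \<in> ?D" "B \<in> ?D"
  then obtain i j where ij: "i \<in> I" "j \<in> I" "A = cylinder i (V i)" "B = cylinder j (V j)" by blast
  obtain k where k: "k \<in> I" "le i k" "le j k" using index_directed ij(1,2) by blast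
  then show "\<exists>C\<in>?D. A \<subseteq> C \<and> B \<subseteq> C"
    using mono ij by (intro bexI[of _ "cylinder k (V k)"]) simp_all
qed

text \<open>The pullback of \<open>W i\<close> belongs to the filter at \<open>j\<close>, and \<open>W j\<close> contains it. Hence a family that
  meets the filters at two indices does so at a common upper bound.\<close>

lemma coherent_in_filter_mono:
  assumes "filter_system F" "coherent_opens W" "i \<in> I" "j \<in> I" "le i j" "W i \<in> F i"
  shows "W j \<in> F j"
  using scott_open_filterinD(2)[OF filter_systemD(1)[OF assms(1,4)]
      filter_systemD(2)[OF assms(1,3,4,5,6)] coherent_opensD(1)[OF assms(2,4)]
      coherent_opensD(2)[OF assms(2,3,4,5)]] .

lemma exists_maximal_coherent:
  assumes F: "filter_system F" and V: "coherent_opens V" "\<And>i. i \<in> I \<Longrightarrow> V i \<notin> F i"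
  obtains W where "coherent_opens W" "\<And>i. i \<in> I \<Longrightarrow> W i \<notin> F i" "\<And>i. i \<in> I \<Longrightarrow> V i \<subseteq> W i"
    "\<And>W' i. \<lbrakk>coherent_opens W'; \<And>i. i \<in> I \<Longrightarrow> W' i \<notin> F i; \<And>i. i \<in> I \<Longrightarrow> W i \<subseteq> W' i; i \<in> I\<rbrakk>
       \<Longrightarrow> W' i \<subseteq> W i"
proof -
  \<comment> \<open>A family is encoded as its graph, so that suprema of chains are plain unions.\<close>
  define \<A> where "\<A> = {R. coherent_opens (\<lambda>i. R `` {i}) \<and> (\<forall>i\<in>I. R `` {i} \<notin> F i) \<and>
      (\<forall>i\<in>I. V i \<subseteq> R `` {i})}"
  have graph: "(Sigma I W') `` {i} = W' i" if "i \<in> I" for W' :: "'i \<Rightarrow> 'a set" and i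
    using that by auto
  have graph_coh: "coherent_opens (\<lambda>i. (Sigma I W') `` {i}) = coherent_opens W'" for W'
    unfolding coherent_opens_def by (simp add: graph)
  have "Sigma I V \<in> \<A>" using V graph graph_coh unfolding \<A>_def by simp
  have chain: "\<Union>\<C> \<in> \<A>" if ne: "\<C> \<noteq> {}" and ch: "subset.chain \<A> \<C>" for \<C>
  proof -
    have mem: "R \<in> \<A>" if "R \<in> \<C>" for R using ch that unfolding subset.chain_def by blast
    have Un: "(\<Union>\<C>) `` {i} = \<Union>((\<lambda>R. R `` {i}) ` \<C>)" for i by blast
    have op: "openin (X i) (R `` {i})" if "R \<in> \<C>" "i \<in> I" for R i
      using mem[OF that(1)] that(2) unfolding \<A>_def coherent_opens_def by blast
    have "coherent_opens (\<lambda>i. (\<Union>\<C>) `` {i})"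
      unfolding coherent_opens_def
    proof (intro conjI ballI impI)
      fix i assume "i \<in> I"
      then show "openin (X i) ((\<Union>\<C>) `` {i})" unfolding Un using op by blast
    next
      fix i j assume ij: "i \<in> I" "j \<in> I" "le i j"
      have "pull i j (R `` {i}) \<subseteq> R `` {j}" if "R \<in> \<C>" for R
        using mem[OF that] ij unfolding \<A>_def coherent_opens_def by blast
      then show "pull i j ((\<Union>\<C>) `` {i}) \<subseteq> (\<Union>\<C>) `` {j}" by blast
    qed
    moreover have "(\<Union>\<C>) `` {i} \<notin> F i" if i: "i \<in> I" for i
    proof
      assume a: "(\<Union>\<C>) `` {i} \<in> F i"
      let ?D = "(\<lambda>R. R `` {i}) ` \<C>"
      have "directed_family ?D"
        unfolding directed_family_def
      proof (intro conjI ballI)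
        show "?D \<noteq> {}" using ne by blast
        fix A B assume "A \<in> ?D" "B \<in> ?D"
        then obtain R S where RS: "R \<in> \<C>" "S \<in> \<C>" "A = R `` {i}" "B = S `` {i}" by blast
        then have "R \<subseteq> S \<or> S \<subseteq> R" using ch unfolding subset.chain_def by blast
        then show "\<exists>C\<in>?D. A \<subseteq> C \<and> B \<subseteq> C" using RS by blast
      qed
      then have "\<exists>U\<in>?D. U \<in> F i"
        by (rule scott_open_filterinD(4)[OF filter_systemD(1)[OF F i]]) (use a Un op i in auto)
      then show False using mem i unfolding \<A>_def by blast
    qed
    moreover have "V i \<subseteq> (\<Union>\<C>) `` {i}" if "i \<in> I" for i
      using ne mem that unfolding \<A>_def by fast
    ultimately show ?thesis unfolding \<A>_def by blast
  qed
  have "\<A> \<noteq> {}" using \<open>Sigma I V \<in> \<A>\<close> by blast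
  from subset_Zorn_nonempty[OF this chain]
  obtain M where M: "M \<in> \<A>" "\<forall>R\<in>\<A>. M \<subseteq> R \<longrightarrow> R = M" by blast
  show ?thesis
  proof (rule that[of "\<lambda>i. M `` {i}"])
    show "coherent_opens (\<lambda>i. M `` {i})" "\<And>i. i \<in> I \<Longrightarrow> M `` {i} \<notin> F i"
      "\<And>i. i \<in> I \<Longrightarrow> V i \<subseteq> M `` {i}"
      using M(1) unfolding \<A>_def by blast+
    fix W' i
    assume W': "coherent_opens W'" "\<And>i. i \<in> I \<Longrightarrow> W' i \<notin> F i" "\<And>i. i \<in> I \<Longrightarrow> M `` {i} \<subseteq> W' i"
      and i: "i \<in> I"
    \<comment> \<open>The graph of the competitor keeps the pairs of the maximal one outside the index set.\<close>
    let ?R = "Sigma I W' \<union> M"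
    have R: "?R `` {k} = W' k" if "k \<in> I" for k using W'(3)[OF that] that by auto
    then have "coherent_opens (\<lambda>i. ?R `` {i})"
      using W'(1) unfolding coherent_opens_def by simp
    moreover have "V k \<subseteq> ?R `` {k}" if "k \<in> I" for k
      using M(1) that unfolding \<A>_def by blast
    ultimately have "?R \<in> \<A>" using R W'(2) unfolding \<A>_def by simp
    then have "?R = M" using bspec[OF M(2), of ?R] by simp
    then show "W' i \<subseteq> M `` {i}" using R[OF i] by simp
  qed
qed

text \<open>This is a relative form of the Hofmann--Mislove theorem and of Steenrod's theorem on limits
  of compact sober spaces at once. In a maximal coherent family that avoids the filters, every
  component is prime, because an open set at stage \<open>i\<close> generates a coherent family from \<open>i\<close>
  onwards. Sobriety turns the components into points. These points are compatible, because
  maximality also forces a component to contain every open set whose pullback is contained in a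
  later component.\<close>

lemma thread_avoiding:
  assumes sober: "\<And>i. i \<in> I \<Longrightarrow> sober_space (X i)"
    and F: "filter_system F" and V: "coherent_opens V" "\<And>i. i \<in> I \<Longrightarrow> V i \<notin> F i"
  obtains x where "x \<in> topspace limit" "\<And>i. i \<in> I \<Longrightarrow> x i \<notin> V i"
    "\<And>i U. i \<in> I \<Longrightarrow> U \<in> F i \<Longrightarrow> x i \<in> U"
proof -
  from exists_maximal_coherent[OF F V]
  obtain W where W: "coherent_opens W" "\<And>i. i \<in> I \<Longrightarrow> W i \<notin> F i" "\<And>i. i \<in> I \<Longrightarrow> V i \<subseteq> W i"
    and max: "\<And>W' i. \<lbrakk>coherent_opens W'; \<And>i. i \<in> I \<Longrightarrow> W' i \<notin> F i;
      \<And>i. i \<in> I \<Longrightarrow> W i \<subseteq> W' i; i \<in> I\<rbrakk> \<Longrightarrow> W' i \<subseteq> W i"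
    by blast
  note Wop = coherent_opensD(1)[OF W(1)] and Wpull = coherent_opensD(2)[OF W(1)]
  have escape: "\<exists>j\<in>I. A j \<union> W j \<in> F j"
    if A: "coherent_opens A" and i: "i \<in> I" "\<not> A i \<subseteq> W i" for A i
    using max[OF coherent_opens_union[OF A W(1)] _ _ i(1)] i(2) by blast
  have prime: "A \<subseteq> W i \<or> B \<subseteq> W i"
    if i: "i \<in> I" and AB: "openin (X i) A" "openin (X i) B" "A \<inter> B \<subseteq> W i" for i A B
  proof (rule ccontr)
    assume n: "\<not> ?thesis"
    let ?A = "\<lambda>j. if le i j then pull i j A else {}"
    let ?B = "\<lambda>j. if le i j then pull i j B else {}"
    note cA = coherent_opens_from[OF i AB(1)] and cB = coherent_opens_from[OF i AB(2)]
    have "\<not> ?A i \<subseteq> W i" "\<not> ?B i \<subseteq> W i"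
      using n le_refl[OF i] pull_refl[OF i openin_subset[OF AB(1)]]
        pull_refl[OF i openin_subset[OF AB(2)]] by simp_all
    then obtain j k where j: "j \<in> I" "?A j \<union> W j \<in> F j" and k: "k \<in> I" "?B k \<union> W k \<in> F k"
      using escape[OF cA i] escape[OF cB i] by blast
    obtain l where l: "l \<in> I" "le j l" "le k l" using index_directed j(1) k(1) by blast
    have "?A l \<union> W l \<in> F l"
      by (rule coherent_in_filter_mono[OF F coherent_opens_union[OF cA W(1)] j(1) l(1,2) j(2)])
    moreover have "?B l \<union> W l \<in> F l"
      by (rule coherent_in_filter_mono[OF F coherent_opens_union[OF cB W(1)] k(1) l(1,3) k(2)])
    ultimately have "(?A l \<union> W l) \<inter> (?B l \<union> W l) \<in> F l"
      by (rule scott_open_filterinD(3)[OF filter_systemD(1)[OF F l(1)]])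
    moreover have "(?A l \<union> W l) \<inter> (?B l \<union> W l) \<subseteq> W l"
      using Wpull[OF i l(1)] AB(3) by auto
    ultimately have "W l \<in> F l"
      using scott_open_filterinD(2)[OF filter_systemD(1)[OF F l(1)] _ Wop[OF l(1)]] by blast
    then show False using W(2) l(1) by blast
  qed
  have proper: "W i \<noteq> topspace (X i)" if i: "i \<in> I" for i
  proof
    assume eq: "W i = topspace (X i)"
    obtain j U where j: "j \<in> I" "U \<in> F j" using filter_systemD(3)[OF F] by blast
    obtain k where k: "k \<in> I" "le i k" "le j k" using index_directed i j(1) by blast
    have "pull j k U \<in> F k" by (rule filter_systemD(2)[OF F j(1) k(1,3) j(2)])
    moreover have "pull j k U \<subseteq> W k" using Wpull[OF i k(1,2)] bonding_in[OF i k(1,2)] eq by auto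
    ultimately have "W k \<in> F k"
      using scott_open_filterinD(2)[OF filter_systemD(1)[OF F k(1)] _ Wop[OF k(1)]] by blast
    then show False using W(2) k(1) by blast
  qed
  have "\<forall>i\<in>I. \<exists>x\<in>topspace (X i). \<forall>U. openin (X i) U \<longrightarrow> (x \<in> U \<longleftrightarrow> \<not> U \<subseteq> W i)"
    using sober_prime_open_generic[OF sober Wop proper prime] by blast
  then obtain x where x: "\<And>i. i \<in> I \<Longrightarrow> x i \<in> topspace (X i)"
    "\<And>i U. i \<in> I \<Longrightarrow> openin (X i) U \<Longrightarrow> x i \<in> U \<longleftrightarrow> \<not> U \<subseteq> W i"
    by metis
  have reflect: "U \<subseteq> W i"
    if ij: "i \<in> I" "j \<in> I" "le i j" and U: "openin (X i) U" "pull i j U \<subseteq> W j" for i j U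
  proof -
    define D where
      "D i = {U. openin (X i) U \<and> (\<exists>j\<in>I. le i j \<and> pull i j U \<subseteq> W j)}" for i
    have D_W: "W k \<in> D k" if "k \<in> I" for k
      using Wop Wpull le_refl that unfolding D_def by blast
    have push: "pull k l U \<in> D l"
      if kl: "k \<in> I" "l \<in> I" "le k l" and "U \<in> D k" for k l U
    proof -
      obtain m where m: "openin (X k) U" "m \<in> I" "le k m" "pull k m U \<subseteq> W m"
        using \<open>U \<in> D k\<close> unfolding D_def by blast
      obtain n where n: "n \<in> I" "le l n" "le m n" using index_directed kl(2) m(2) by blast
      have "pull l n (pull k l U) = pull m n (pull k m U)"
        using pull_pull[OF kl(1,2) n(1) kl(3) n(2)] pull_pull[OF kl(1) m(2) n(1) m(3) n(3)]
        by simp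
      also have "\<dots> \<subseteq> W n" using Wpull[OF m(2) n(1,3)] m(4) by blast
      finally show ?thesis unfolding D_def using pull_open[OF kl m(1)] n by blast
    qed
    have "(\<Union>(D i)) \<subseteq> W i"
    proof (rule max)
      show "coherent_opens (\<lambda>i. \<Union>(D i))"
        unfolding coherent_opens_def
      proof (intro conjI ballI impI)
        fix k show "openin (X k) (\<Union>(D k))" unfolding D_def by blast
      next
        fix k l assume kl: "k \<in> I" "l \<in> I" "le k l"
        show "pull k l (\<Union>(D k)) \<subseteq> \<Union>(D l)" using push[OF kl] by blast
      qed
      show "W k \<subseteq> \<Union>(D k)" if "k \<in> I" for k using D_W[OF that] by blast
      show "\<Union>(D k) \<notin> F k" if k: "k \<in> I" for k
      proof
        assume a: "\<Union>(D k) \<in> F k"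
        have "directed_family (D k)"
          unfolding directed_family_def
        proof (intro conjI ballI)
          show "D k \<noteq> {}" using D_W[OF k] by blast
          fix A B assume "A \<in> D k" "B \<in> D k"
          then obtain l m where l: "openin (X k) A" "l \<in> I" "le k l" "pull k l A \<subseteq> W l"
            and m: "openin (X k) B" "m \<in> I" "le k m" "pull k m B \<subseteq> W m"
            unfolding D_def by blast
          obtain n where n: "n \<in> I" "le l n" "le m n" using index_directed l(2) m(2) by blast
          have "pull k n A \<subseteq> W n"
            using pull_pull[OF k l(2) n(1) l(3) n(2), of A] Wpull[OF l(2) n(1,2)] l(4) by blast
          moreover have "pull k n B \<subseteq> W n"
            using pull_pull[OF k m(2) n(1) m(3) n(3), of B] Wpull[OF m(2) n(1,3)] m(4) by blast
          ultimately have "pull k n (A \<union> B) \<subseteq> W n" by blast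
          then have "A \<union> B \<in> D k"
            unfolding D_def using l(1) m(1) n(1) le_trans[OF k l(2) n(1) l(3) n(2)] by blast
          then show "\<exists>C\<in>D k. A \<subseteq> C \<and> B \<subseteq> C" by blast
        qed
        then obtain U where "U \<in> D k" "U \<in> F k"
          using scott_open_filterinD(4)[OF filter_systemD(1)[OF F k] _ _ a] unfolding D_def by blast
        then obtain l where l: "l \<in> I" "le k l" "pull k l U \<subseteq> W l" unfolding D_def by blast
        have "W l \<in> F l"
          by (rule scott_open_filterinD(2)[OF filter_systemD(1)[OF F l(1)]
                filter_systemD(2)[OF F k l(1,2) \<open>U \<in> F k\<close>] Wop[OF l(1)] l(3)])
        then show False using W(2) l(1) by blast
      qed
    qed (rule ij(1))
    then show ?thesis using U ij unfolding D_def by blast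
  qed
  have compat: "p i j (x j) = x i" if ij: "i \<in> I" "j \<in> I" "le i j" for i j
  proof -
    have "p i j (x j) \<in> U \<longleftrightarrow> x i \<in> U" if U: "openin (X i) U" for U
    proof -
      have "p i j (x j) \<in> U \<longleftrightarrow> x j \<in> pull i j U" using x(1) ij by blast
      also have "\<dots> \<longleftrightarrow> \<not> pull i j U \<subseteq> W j" by (rule x(2)[OF ij(2) pull_open[OF ij U]])
      also have "\<dots> \<longleftrightarrow> \<not> U \<subseteq> W i" using reflect[OF ij U] Wpull[OF ij] by blast
      also have "\<dots> \<longleftrightarrow> x i \<in> U" using x(2)[OF ij(1) U] by simp
      finally show ?thesis .
    qed
    moreover have "t0_space (X i)" using sober ij(1) unfolding sober_space_def by blast
    moreover have "p i j (x j) \<in> topspace (X i)" "x i \<in> topspace (X i)"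
      using bonding_in[OF ij] x(1) ij by blast+
    ultimately show ?thesis unfolding t0_space_def by metis
  qed
  show ?thesis
  proof (rule that[of "restrict x I"])
    show "restrict x I \<in> topspace limit"
      unfolding topspace_limit using x(1) compat by auto
    show "restrict x I i \<notin> V i" if i: "i \<in> I" for i
      using x(2)[OF i Wop[OF i]] W(3)[OF i] i by auto
    show "restrict x I i \<in> U" if i: "i \<in> I" and U: "U \<in> F i" for i U
    proof -
      have "\<not> U \<subseteq> W i"
        using scott_open_filterinD(2)[OF filter_systemD(1)[OF F i] U Wop[OF i]] W(2)[OF i] by blast
      then show ?thesis
        using x(2)[OF i scott_open_filterinD(1)[OF filter_systemD(1)[OF F i] U]] i by simp
    qed
  qed
qed


section \<open>Limits of filters, of irreducible closed sets and of closed sets\<close>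

text \<open>Taking cores is the right adjoint of taking cylinders.\<close>

definition core :: "'i \<Rightarrow> ('i \<Rightarrow> 'a) set \<Rightarrow> 'a set" where
  "core i W = \<Union>{U. openin (X i) U \<and> cylinder i U \<subseteq> W}"

lemma core_open: "openin (X i) (core i W)"
  unfolding core_def by blast

lemma cylinder_core: "cylinder i (core i W) \<subseteq> W"
  unfolding core_def by blast

lemma subset_core: "openin (X i) U \<Longrightarrow> cylinder i U \<subseteq> W \<Longrightarrow> U \<subseteq> core i W"
  unfolding core_def by blast

lemma core_mono: "W \<subseteq> W' \<Longrightarrow> core i W \<subseteq> core i W'"
  unfolding core_def by blast

lemma pull_core:
  assumes "i \<in> I" "j \<in> I" "le i j"
  shows "pull i j (core i W) \<subseteq> core j W"
proof (rule subset_core)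
  show "openin (X j) (pull i j (core i W))" by (rule pull_open[OF assms core_open])
  show "cylinder j (pull i j (core i W)) \<subseteq> W" using cylinder_pull[OF assms] cylinder_core by simp
qed

lemma in_core:
  assumes "openin limit W" "x \<in> W"
  shows "\<exists>i\<in>I. x i \<in> core i W"
proof -
  obtain i U where "i \<in> I" "openin (X i) U" "x i \<in> U" "cylinder i U \<subseteq> W"
    by (rule cylinder_base[OF assms])
  then show ?thesis using subset_core by blast
qed

text \<open>A directed cover of the limit set of the filters is turned into a coherent family by taking
  the union of the cores of its members at each index. If this family avoided the filters, then
  it would miss a thread of the limit set.\<close>

lemma filter_limit_cover:
  assumes sober: "\<And>i. i \<in> I \<Longrightarrow> sober_space (X i)" and F: "filter_system F"
    and D: "directed_family D" "\<And>W. W \<in> D \<Longrightarrow> openin limit W"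
    and cover: "{x \<in> topspace limit. \<forall>i\<in>I. \<forall>U\<in>F i. x i \<in> U} \<subseteq> \<Union>D"
  obtains W i U where "W \<in> D" "i \<in> I" "U \<in> F i" "cylinder i U \<subseteq> W"
proof -
  let ?V = "\<lambda>i. \<Union>(core i ` D)"
  have V: "coherent_opens ?V"
    unfolding coherent_opens_def
  proof (intro conjI ballI impI)
    show "openin (X i) (?V i)" for i using core_open by blast
    fix i j assume ij: "i \<in> I" "j \<in> I" "le i j"
    show "pull i j (?V i) \<subseteq> ?V j" using pull_core[OF ij] by blast
  qed
  have "\<exists>i\<in>I. ?V i \<in> F i"
  proof (rule ccontr)
    assume "\<not> ?thesis"
    then have "?V i \<notin> F i" if "i \<in> I" for i using that by blast
    from thread_avoiding[OF sober F V this]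
    obtain x where x: "x \<in> topspace limit" "\<And>i. i \<in> I \<Longrightarrow> x i \<notin> ?V i"
      "\<And>i U. i \<in> I \<Longrightarrow> U \<in> F i \<Longrightarrow> x i \<in> U"
      by blast
    have "x \<in> \<Union>D" by (rule subsetD[OF cover]) (use x(1,3) in simp)
    then obtain W where W: "W \<in> D" "x \<in> W" by blast
    then obtain i where "i \<in> I" "x i \<in> core i W" using in_core D(2) by blast
    then show False using x(2) W(1) by blast
  qed
  then obtain i where i: "i \<in> I" "?V i \<in> F i" by blast
  have "directed_family (core i ` D)" by (rule directed_family_image[OF D(1) core_mono])
  then have "\<exists>U\<in>core i ` D. U \<in> F i"
    by (rule scott_open_filterinD(4)[OF filter_systemD(1)[OF F i(1)]]) (use core_open i(2) in auto)
  then obtain W where "W \<in> D" "core i W \<in> F i" by blast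
  then show ?thesis using that i(1) cylinder_core by blast
qed

lemma sober_limit:
  assumes sober: "\<And>i. i \<in> I \<Longrightarrow> sober_space (X i)"
  shows "sober_space limit"
  unfolding sober_space_def
proof (intro conjI allI impI)
  have t0: "t0_space (X i)" if "i \<in> I" for i using sober[OF that] unfolding sober_space_def by blast
  show "t0_space limit"
    unfolding t0_space_def
  proof (intro ballI impI)
    fix x y assume xy: "x \<in> topspace limit" "y \<in> topspace limit" "x \<noteq> y"
    then obtain i where i: "i \<in> I" "x i \<noteq> y i" using limit_eqI by blast
    then obtain U where U: "openin (X i) U" "x i \<notin> U \<longleftrightarrow> y i \<in> U"
      using t0[OF i(1)] limit_coord xy(1,2) unfolding t0_space_def by meson
    show "\<exists>U. openin limit U \<and> (x \<notin> U \<longleftrightarrow> y \<in> U)"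
      using cylinder_open[OF i(1) U(1)] U(2) xy(1,2) by (intro exI[of _ "cylinder i U"]) auto
  qed
  fix C assume "irreducible_closedin limit C"
  then have C: "closedin limit C" "C \<noteq> {}"
    and irr: "\<And>A B. closedin limit A \<Longrightarrow> closedin limit B \<Longrightarrow> C \<subseteq> A \<union> B \<Longrightarrow> C \<subseteq> A \<or> C \<subseteq> B"
    unfolding irreducible_closedin_def by blast+
  have Csub: "C \<subseteq> topspace limit" using C(1) closedin_subset by blast
  have meets: "C \<inter> A \<inter> B \<noteq> {}"
    if "openin limit A" "openin limit B" "C \<inter> A \<noteq> {}" "C \<inter> B \<noteq> {}" for A B
    using irr[of "topspace limit - A" "topspace limit - B"] that Csub by blast
  \<comment> \<open>The closures of the projections are irreducible, and their generic points form a thread.\<close>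
  have "\<exists>x\<in>topspace (X i). \<forall>U. openin (X i) U \<longrightarrow> (x \<in> U \<longleftrightarrow> C \<inter> cylinder i U \<noteq> {})"
    if i: "i \<in> I" for i
  proof -
    let ?W = "\<Union>{U. openin (X i) U \<and> C \<inter> cylinder i U = {}}"
    have W: "C \<inter> cylinder i ?W = {}" by blast
    have leW: "U \<subseteq> ?W \<longleftrightarrow> C \<inter> cylinder i U = {}" if "openin (X i) U" for U
      using W that by blast
    have "\<exists>x\<in>topspace (X i). \<forall>U. openin (X i) U \<longrightarrow> (x \<in> U \<longleftrightarrow> \<not> U \<subseteq> ?W)"
    proof (rule sober_prime_open_generic[OF sober[OF i]])
      show "openin (X i) ?W" by blast
      show "?W \<noteq> topspace (X i)"
        using W C(2) Csub limit_coord[OF _ i] by blast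
      fix A B assume AB: "openin (X i) A" "openin (X i) B" "A \<inter> B \<subseteq> ?W"
      have "C \<inter> cylinder i A \<inter> cylinder i B = {}" using AB(3) W by blast
      then show "A \<subseteq> ?W \<or> B \<subseteq> ?W"
        using meets[OF cylinder_open[OF i AB(1)] cylinder_open[OF i AB(2)]] leW AB(1,2) by blast
    qed
    then show ?thesis using leW by simp
  qed
  then have "\<exists>x. \<forall>i\<in>I. x i \<in> topspace (X i) \<and>
      (\<forall>U. openin (X i) U \<longrightarrow> (x i \<in> U \<longleftrightarrow> C \<inter> cylinder i U \<noteq> {}))"
    by (intro bchoice ballI) (simp add: Bex_def)
  then obtain x where "\<forall>i\<in>I. x i \<in> topspace (X i) \<and>
      (\<forall>U. openin (X i) U \<longrightarrow> (x i \<in> U \<longleftrightarrow> C \<inter> cylinder i U \<noteq> {}))"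
    by (rule exE)
  then have x: "\<And>i. i \<in> I \<Longrightarrow> x i \<in> topspace (X i)"
    "\<And>i U. i \<in> I \<Longrightarrow> openin (X i) U \<Longrightarrow> x i \<in> U \<longleftrightarrow> C \<inter> cylinder i U \<noteq> {}"
    by blast+
  have compat: "p i j (x j) = x i" if ij: "i \<in> I" "j \<in> I" "le i j" for i j
  proof -
    have "p i j (x j) \<in> U \<longleftrightarrow> x i \<in> U" if U: "openin (X i) U" for U
    proof -
      have "p i j (x j) \<in> U \<longleftrightarrow> x j \<in> pull i j U" using x(1) ij by blast
      also have "\<dots> \<longleftrightarrow> x i \<in> U"
        using x(2)[OF ij(2) pull_open[OF ij U]] x(2)[OF ij(1) U] cylinder_pull[OF ij] by simp
      finally show ?thesis .
    qed
    then show ?thesis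
      using t0[OF ij(1)] bonding_in[OF ij] x(1) ij unfolding t0_space_def by metis
  qed
  let ?x = "restrict x I"
  have xL: "?x \<in> topspace limit" unfolding topspace_limit using x(1) compat by auto
  have "?x \<in> W \<longleftrightarrow> C \<inter> W \<noteq> {}" if W: "openin limit W" for W
  proof
    assume "?x \<in> W"
    then obtain i where i: "i \<in> I" "?x i \<in> core i W" using in_core W by blast
    then have "C \<inter> cylinder i (core i W) \<noteq> {}" using x(2)[OF i(1) core_open] by simp
    then show "C \<inter> W \<noteq> {}" using cylinder_core by blast
  next
    assume "C \<inter> W \<noteq> {}"
    then obtain y where y: "y \<in> C" "y \<in> W" by blast
    then obtain i where i: "i \<in> I" "y i \<in> core i W" using in_core W by blast
    then have "x i \<in> core i W" using x(2)[OF i(1) core_open] y(1) Csub by blast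
    then show "?x \<in> W" using cylinder_core[of i W] i(1) xL by auto
  qed
  then have "limit closure_of {?x} = limit closure_of C"
    unfolding closure_of_def by blast
  then show "\<exists>x\<in>topspace limit. C = limit closure_of {x}"
    using closure_of_closedin[OF C(1)] xL by metis
qed

text \<open>The second condition says that \<open>C i\<close> is the closure of the image of \<open>C j\<close>, in terms of the open
  sets that both of them meet.\<close>

definition closed_system :: "('i \<Rightarrow> 'a set) \<Rightarrow> bool" where
  "closed_system C \<longleftrightarrow>
     (\<forall>i\<in>I. closedin (X i) (C i)) \<and>
     (\<forall>i\<in>I. \<forall>j\<in>I. \<forall>U. le i j \<and> openin (X i) U \<longrightarrow> (C i \<inter> U \<noteq> {} \<longleftrightarrow> C j \<inter> pull i j U \<noteq> {}))"

lemma closed_systemD: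
  assumes "closed_system C"
  shows "i \<in> I \<Longrightarrow> closedin (X i) (C i)"
    and "\<lbrakk>i \<in> I; j \<in> I; le i j; openin (X i) U\<rbrakk> \<Longrightarrow> C i \<inter> U \<noteq> {} \<longleftrightarrow> C j \<inter> pull i j U \<noteq> {}"
  using assms unfolding closed_system_def by meson+

lemma closed_system_maps:
  assumes C: "closed_system C" and ij: "i \<in> I" "j \<in> I" "le i j" and x: "x \<in> C j"
  shows "p i j x \<in> C i"
proof -
  have "x \<in> topspace (X j)" using closedin_subset[OF closed_systemD(1)[OF C ij(2)]] x by blast
  moreover have "openin (X i) (topspace (X i) - C i)" using closed_systemD(1)[OF C ij(1)] by blast
  then have "C j \<inter> pull i j (topspace (X i) - C i) = {}"
    using closed_systemD(2)[OF C ij] by blast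
  ultimately show ?thesis using bonding_in[OF ij] x by blast
qed

text \<open>A thread through the closed sets exists as soon as there are filters whose members all meet
  them: the complements of the closed sets are a coherent family.\<close>

lemma thread_through_closed:
  assumes sober: "\<And>i. i \<in> I \<Longrightarrow> sober_space (X i)" and C: "closed_system C"
    and F: "filter_system F" "\<And>i U. i \<in> I \<Longrightarrow> U \<in> F i \<Longrightarrow> C i \<inter> U \<noteq> {}"
  obtains x where "x \<in> topspace limit" "\<And>i. i \<in> I \<Longrightarrow> x i \<in> C i"
    "\<And>i U. i \<in> I \<Longrightarrow> U \<in> F i \<Longrightarrow> x i \<in> U"
proof -
  let ?V = "\<lambda>i. topspace (X i) - C i"
  have V: "coherent_opens ?V"
    unfolding coherent_opens_def
  proof (intro conjI ballI impI)
    show "openin (X i) (?V i)" if "i \<in> I" for i using closed_systemD(1)[OF C that] by blast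
    fix i j assume "i \<in> I" "j \<in> I" "le i j"
    then show "pull i j (?V i) \<subseteq> ?V j" using closed_system_maps[OF C] by blast
  qed
  have "?V i \<notin> F i" if "i \<in> I" for i using F(2)[OF that] by blast
  from thread_avoiding[OF sober F(1) V this] obtain x where x: "x \<in> topspace limit"
    "\<And>i. i \<in> I \<Longrightarrow> x i \<notin> ?V i" "\<And>i U. i \<in> I \<Longrightarrow> U \<in> F i \<Longrightarrow> x i \<in> U"
    by blast
  moreover have "x i \<in> C i" if "i \<in> I" for i using x(2)[OF that] limit_coord[OF x(1) that] by blast
  ultimately show ?thesis using that by blast
qed

text \<open>Properness makes the part of \<open>C j\<close> above a point \<open>c\<close> of \<open>C i\<close> compact and nonempty. Its
  neighbourhoods are the filter at \<open>j\<close>, which forces the thread to be above \<open>c\<close> at \<open>i\<close>. There is such a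
  part for \<open>j\<close> after \<open>i\<close> only, and the other filters are empty.\<close>

lemma closed_system_thread_proper:
  assumes sober: "\<And>i. i \<in> I \<Longrightarrow> sober_space (X i)" and C: "closed_system C"
    and proper: "\<And>i j. i \<in> I \<Longrightarrow> j \<in> I \<Longrightarrow> le i j \<Longrightarrow> sat_proper_map (X j) (X i) (p i j)"
    and i: "i \<in> I" and U: "openin (X i) U" "C i \<inter> U \<noteq> {}"
  shows "\<exists>x\<in>topspace limit. x i \<in> U \<and> (\<forall>j\<in>I. x j \<in> C j)"
proof -
  obtain c where c: "c \<in> C i" "c \<in> U" using U(2) by blast
  then have cX: "c \<in> topspace (X i)" using U(1) openin_subset by blast
  let ?up = "up_closure (X i) {c}"
  have up: "compact_saturatedin (X i) ?up"
    by (rule compact_saturatedin_up_closure) (simp add: finite_imp_compactin cX)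
  define K where "K j = pull i j ?up \<inter> C j" for j
  define F where "F j = (if le i j then {V. openin (X j) V \<and> K j \<subseteq> V} else {})" for j
  have cK: "compactin (X j) (K j)" if j: "j \<in> I" "le i j" for j
  proof -
    have "compactin (X j) (pull i j ?up)"
      using proper[OF i j] up unfolding sat_proper_map_def compact_saturatedin_def by blast
    from closed_Int_compactin[OF closed_systemD(1)[OF C j(1)] this]
    show ?thesis unfolding K_def by (subst Int_commute)
  qed
  \<comment> \<open>The downward closure of the image of \<open>C j\<close> is closed and therefore contains \<open>c\<close>.\<close>
  have neK: "K j \<noteq> {}" if j: "j \<in> I" "le i j" for j
  proof
    assume e: "K j = {}"
    let ?D = "down_closure (X i) (p i j ` C j)"
    have Csub: "C j \<subseteq> topspace (X j)" by (rule closedin_subset[OF closed_systemD(1)[OF C j(1)]])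
    have "closedin (X i) ?D"
      using proper[OF i j] closed_systemD(1)[OF C j(1)] unfolding sat_proper_map_def by blast
    then have op: "openin (X i) (topspace (X i) - ?D)" by blast
    have "c \<notin> ?D"
      using e Csub unfolding K_def down_closure_def up_closure_def by auto
    then have "C i \<inter> (topspace (X i) - ?D) \<noteq> {}" using c(1) cX by blast
    then obtain x where x: "x \<in> C j" "p i j x \<in> topspace (X i)" "p i j x \<notin> ?D"
      using closed_systemD(2)[OF C i j op] by blast
    then have "p i j x \<in> ?D" unfolding down_closure_def spec_le_def by blast
    then show False using x(3) by blast
  qed
  have F: "filter_system F"
    unfolding filter_system_def
  proof (intro conjI ballI allI impI)
    show "scott_open_filterin (X j) (F j)" if j: "j \<in> I" for j
      using scott_open_filterin_compact[OF cK[OF j]] scott_open_filterin_empty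
      unfolding F_def by auto
    show "\<exists>j\<in>I. F j \<noteq> {}"
    proof (rule bexI[OF _ i])
      have "topspace (X i) \<in> F i"
        using le_refl[OF i] compactin_subset_topspace[OF cK[OF i le_refl[OF i]]]
        unfolding F_def by simp
      then show "F i \<noteq> {}" by blast
    qed
    fix j k V assume jk: "j \<in> I" "k \<in> I" and "le j k \<and> V \<in> F j"
    then have a: "le j k" "le i j" "openin (X j) V" "K j \<subseteq> V"
      unfolding F_def by (auto split: if_splits)
    have ik: "le i k" by (rule le_trans[OF i jk a(2,1)])
    have "K k \<subseteq> pull j k (K j)"
      using pull_pull[OF i jk a(2,1), of ?up] closed_system_maps[OF C jk a(1)]
      unfolding K_def by blast
    then have "K k \<subseteq> pull j k V" using a(4) by blast
    then show "pull j k V \<in> F k" unfolding F_def using ik pull_open[OF jk a(1,3)] by simp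
  qed
  have "C j \<inter> V \<noteq> {}" if "j \<in> I" "V \<in> F j" for j V
    using that neK[OF that(1)] unfolding F_def K_def by (auto split: if_splits)
  from thread_through_closed[OF sober C F this] obtain x where x: "x \<in> topspace limit"
    "\<And>i. i \<in> I \<Longrightarrow> x i \<in> C i" "\<And>i U. i \<in> I \<Longrightarrow> U \<in> F i \<Longrightarrow> x i \<in> U"
    by blast
  have "U \<in> F i"
  proof -
    have "?up \<subseteq> U" using c(2) U(1) unfolding up_closure_def spec_le_def by blast
    then have "K i \<subseteq> U" unfolding K_def using bonding_id[OF i] by auto
    then show ?thesis unfolding F_def using U(1) le_refl[OF i] by simp
  qed
  then show ?thesis using x i by blast
qed

text \<open>In this case the filters come from a sequence of compact sets along a cofinal sequence of
  indices, each one a neighbourhood of a point of the closed set at its index. Local compactness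
  supplies the next compact set inside the pullback of an open set in the previous one, so that the
  bonding maps send every compact set into the earlier ones.\<close>

lemma closed_system_thread_locally_compact:
  assumes sober: "\<And>i. i \<in> I \<Longrightarrow> sober_space (X i)" and C: "closed_system C"
    and cof: "has_countable_cofinal_subset I le"
    and lc: "\<And>i. i \<in> I \<Longrightarrow> base_locally_compact_space (X i)"
    and i: "i \<in> I" and U: "openin (X i) U" "C i \<inter> U \<noteq> {}"
  shows "\<exists>x\<in>topspace limit. x i \<in> U \<and> (\<forall>j\<in>I. x j \<in> C j)"
proof -
  obtain J where J: "J \<subseteq> I" "countable J" "\<forall>i\<in>I. \<exists>j\<in>J. le i j"
    using cof unfolding has_countable_cofinal_subset_def by blast
  have "J \<noteq> {}" using J(3) i by blast
  \<comment> \<open>A state of the construction is an index, an open set that meets the closed set there, and a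
    compact set around it. Each step also moves beyond the next index of the cofinal sequence.\<close>
  define r where "r = from_nat_into J"
  have rI: "r n \<in> I" for n using from_nat_into[OF \<open>J \<noteq> {}\<close>] J(1) unfolding r_def by blast
  have r_cof: "\<exists>n. le j (r n)" if "j \<in> I" for j
    using J that from_nat_into_surj[OF J(2)] unfolding r_def by metis
  define good where "good = (\<lambda>(s, O', K). s \<in> I \<and> openin (X s) O' \<and> compactin (X s) K \<and>
      O' \<subseteq> K \<and> C s \<inter> O' \<noteq> {})"
  define step where "step = (\<lambda>n (s, O', K :: 'a set) (s', O'' :: 'a set, K').
      le s s' \<and> le (r n) s' \<and> K' \<subseteq> pull s s' O')"
  have next_set: "\<exists>O'' K. good (s', O'', K) \<and> K \<subseteq> pull s s' O'"
    if s: "s \<in> I" "s' \<in> I" "le s s'" and O': "openin (X s) O'" "C s \<inter> O' \<noteq> {}" for s s' O'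
  proof -
    obtain c where c: "c \<in> C s'" "c \<in> pull s s' O'" using closed_systemD(2)[OF C s O'(1)] O'(2) by blast
    have "neighbourhood_base_of (compactin (X s')) (X s')"
      using lc[OF s(2)] unfolding base_locally_compact_space_def .
    from this[unfolded neighbourhood_base_of, rule_format, OF conjI[OF pull_open[OF s O'(1)] c(2)]]
    obtain O'' K where "openin (X s') O''" "compactin (X s') K" "c \<in> O''" "O'' \<subseteq> K"
        "K \<subseteq> pull s s' O'"
      by blast
    then show ?thesis unfolding good_def using s(2) c(1) by blast
  qed
  have "\<exists>f. \<forall>n :: nat. (good (f n) \<and> (n = 0 \<longrightarrow> le i (fst (f n)) \<and> snd (snd (f n)) \<subseteq> pull i (fst (f n)) U)) \<and>
      step n (f n) (f (Suc n))"
  proof (rule dependent_nat_choice)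
    show "\<exists>x. good x \<and> ((0 :: nat) = 0 \<longrightarrow> le i (fst x) \<and> snd (snd x) \<subseteq> pull i (fst x) U)"
      using next_set[OF i i le_refl[OF i] U] le_refl[OF i] by fastforce
    fix x and n :: nat
    assume "good x \<and> (n = 0 \<longrightarrow> le i (fst x) \<and> snd (snd x) \<subseteq> pull i (fst x) U)"
    moreover obtain s O' K where x: "x = (s, O', K)" by (cases x)
    ultimately have s: "s \<in> I" "openin (X s) O'" "C s \<inter> O' \<noteq> {}" unfolding good_def by auto
    obtain s' where s': "s' \<in> I" "le s s'" "le (r n) s'" using index_directed s(1) rI by blast
    from next_set[OF s(1) s'(1,2) s(2,3)]
    obtain O'' K' where "good (s', O'', K')" "K' \<subseteq> pull s s' O'" by blast
    then show "\<exists>y. (good y \<and> (Suc n = 0 \<longrightarrow> le i (fst y) \<and> snd (snd y) \<subseteq> pull i (fst y) U)) \<and>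
        step n x y"
      unfolding step_def x using s' by (intro exI[of _ "(s', O'', K')"]) auto
  qed
  then obtain f where f: "\<And>n :: nat. good (f n)" "le i (fst (f 0))"
      "snd (snd (f 0)) \<subseteq> pull i (fst (f 0)) U" "\<And>n :: nat. step n (f n) (f (Suc n))"
    by blast
  define s where "s n = fst (f n)" for n
  define G where "G n = fst (snd (f n))" for n
  define K where "K n = snd (snd (f n))" for n
  have f_eq: "f n = (s n, G n, K n)" for n unfolding s_def G_def K_def by simp
  have sI: "s n \<in> I" and cK: "compactin (X (s n)) (K n)" and GK: "G n \<subseteq> K n"
    and CG: "C (s n) \<inter> G n \<noteq> {}" for n
    using f(1)[of n] unfolding f_eq good_def by auto
  have st: "le (s n) (s (Suc n))" "le (r n) (s (Suc n))"
      "K (Suc n) \<subseteq> pull (s n) (s (Suc n)) (G n)" for n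
    using f(4)[of n] unfolding f_eq step_def by auto
  have mono: "le (s m) (s n) \<and> K n \<subseteq> pull (s m) (s n) (K m)" if "m \<le> n" for m n
    using that
  proof (induction n rule: dec_induct)
    case base
    show ?case
      using le_refl[OF sI] bonding_id[OF sI] compactin_subset_topspace[OF cK[of m]] by auto
  next
    case (step n)
    have "K (Suc n) \<subseteq> pull (s n) (s (Suc n)) (pull (s m) (s n) (K m))"
      using st(3)[of n] GK[of n] step.IH by blast
    then show ?case
      using pull_pull[OF sI sI sI, of m n "Suc n"] step.IH st(1)[of n]
        le_trans[OF sI sI sI, of m n "Suc n"] by simp
  qed
  have s_cof: "\<exists>n. le j (s n)" if j: "j \<in> I" for j
  proof -
    obtain n where "le j (r n)" using r_cof[OF j] by blast
    then have "le j (s (Suc n))" using le_trans[OF j rI sI _ st(2)] by blast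
    then show ?thesis by blast
  qed
  define F where "F j = {V. openin (X j) V \<and> (\<exists>n. le j (s n) \<and> K n \<subseteq> pull j (s n) V)}" for j
  have later: "le j (s n) \<and> K n \<subseteq> pull j (s n) V"
    if j: "j \<in> I" and m: "le j (s m)" "K m \<subseteq> pull j (s m) V" and mn: "m \<le> n" for j m n V
  proof -
    have "K n \<subseteq> pull (s m) (s n) (pull j (s m) V)" using mono[OF mn] m(2) by blast
    then show ?thesis
      using pull_pull[OF j sI sI m(1)] mono[OF mn] le_trans[OF j sI sI m(1)] by simp
  qed
  have F: "filter_system F"
    unfolding filter_system_def
  proof (intro conjI ballI allI impI)
    fix j assume j: "j \<in> I"
    show "scott_open_filterin (X j) (F j)"
      unfolding scott_open_filterin_def
    proof (intro conjI ballI allI impI)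
      show "openin (X j) V" if "V \<in> F j" for V using that unfolding F_def by blast
      show "W \<in> F j" if "V \<in> F j \<and> openin (X j) W \<and> V \<subseteq> W" for V W
        using that unfolding F_def by blast
      show "V \<inter> W \<in> F j" if V: "V \<in> F j" and W: "W \<in> F j" for V W
      proof -
        obtain m n where mn: "le j (s m)" "K m \<subseteq> pull j (s m) V" "le j (s n)" "K n \<subseteq> pull j (s n) W"
          "openin (X j) V" "openin (X j) W"
          using V W unfolding F_def by blast
        have "K (max m n) \<subseteq> pull j (s (max m n)) (V \<inter> W)" "le j (s (max m n))"
          using later[OF j mn(1,2), of "max m n"] later[OF j mn(3,4), of "max m n"] by auto
        then show ?thesis unfolding F_def using mn(5,6) by blast
      qed
      fix D assume D: "directed_family D \<and> (\<forall>U\<in>D. openin (X j) U) \<and> \<Union>D \<in> F j"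
      then obtain n where n: "le j (s n)" "K n \<subseteq> pull j (s n) (\<Union>D)" unfolding F_def by blast
      let ?E = "pull j (s n) ` D"
      have "directed_family ?E" by (rule directed_family_image) (use D in auto)
      moreover have "\<forall>V\<in>?E. openin (X (s n)) V" using pull_open[OF j sI n(1)] D by blast
      moreover have "K n \<subseteq> \<Union>?E" using n(2) by blast
      ultimately obtain V where "V \<in> ?E" "K n \<subseteq> V"
        using cK[of n] unfolding compactin_iff_directed_cover by meson
      then show "\<exists>U\<in>D. U \<in> F j" unfolding F_def using D n(1) by blast
    qed
  next
    fix j k V assume jk: "j \<in> I" "k \<in> I" and "le j k \<and> V \<in> F j"
    then obtain m where m: "le j k" "openin (X j) V" "le j (s m)" "K m \<subseteq> pull j (s m) V"
      unfolding F_def by blast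
    obtain n where n: "le k (s n)" using s_cof[OF jk(2)] by blast
    have kn: "le k (s (max m n))"
      using le_trans[OF jk(2) sI sI n] mono[of n "max m n"] by simp
    have "K (max m n) \<subseteq> pull k (s (max m n)) (pull j k V)"
      using later[OF jk(1) m(3,4), of "max m n"] pull_pull[OF jk sI m(1) kn] by simp
    then show "pull j k V \<in> F k" unfolding F_def using pull_open[OF jk m(1,2)] kn by blast
  next
    have "K 0 \<subseteq> pull i (s 0) U" "le i (s 0)" using f(2,3) unfolding K_def s_def by blast+
    then show "\<exists>i\<in>I. F i \<noteq> {}" unfolding F_def using i U(1) by blast
  qed
  have "C j \<inter> V \<noteq> {}" if j: "j \<in> I" and V: "V \<in> F j" for j V
  proof -
    obtain n where n: "le j (s n)" "K n \<subseteq> pull j (s n) V" using V unfolding F_def by blast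
    obtain c where "c \<in> C (s n)" "c \<in> K n" using CG[of n] GK[of n] by blast
    then show ?thesis using closed_system_maps[OF C j sI n(1)] n(2) by blast
  qed
  from thread_through_closed[OF sober C F this] obtain x where x: "x \<in> topspace limit"
    "\<And>i. i \<in> I \<Longrightarrow> x i \<in> C i" "\<And>i U. i \<in> I \<Longrightarrow> U \<in> F i \<Longrightarrow> x i \<in> U"
    by blast
  have "U \<in> F i" unfolding F_def using U(1) f(2,3) unfolding K_def s_def by blast
  then show ?thesis using x i by blast
qed


section \<open>Recognising a projective limit\<close>

lemma continuous_map_into_limit:
  assumes "\<And>i. i \<in> I \<Longrightarrow> continuous_map Y (X i) (q i)"
    and "\<And>i j y. \<lbrakk>i \<in> I; j \<in> I; le i j; y \<in> topspace Y\<rbrakk> \<Longrightarrow> p i j (q j y) = q i y"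
  shows "continuous_map Y limit (\<lambda>y. \<lambda>i\<in>I. q i y)"
  unfolding canonical_limit_def continuous_map_in_subtopology
proof
  have "continuous_map Y (X i) (\<lambda>y. (\<lambda>i\<in>I. q i y) i)" if "i \<in> I" for i
    using assms(1)[OF that] that by simp
  then show "continuous_map Y (product_topology X I) (\<lambda>y. \<lambda>i\<in>I. q i y)"
    unfolding continuous_map_componentwise by auto
  show "(\<lambda>y. \<lambda>i\<in>I. q i y) \<in> topspace Y \<rightarrow>
      {x \<in> (\<Pi>\<^sub>E i\<in>I. topspace (X i)). \<forall>i\<in>I. \<forall>j\<in>I. le i j \<longrightarrow> p i j (x j) = x i}"
    using assms continuous_map_funspace by fastforce
qed

text \<open>The last assumption says that the topology generated by \<open>S\<close> is initial for the maps \<open>q i\<close>.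
  Because the cylinders are a base of the limit, single indices suffice there.\<close>

lemma is_projective_limitI:
  assumes cont: "\<And>i. i \<in> I \<Longrightarrow> continuous_map (topology_generated_by S) (X i) (q i)"
    and compat: "\<And>i j y. \<lbrakk>i \<in> I; j \<in> I; le i j; y \<in> \<Union>S\<rbrakk> \<Longrightarrow> p i j (q j y) = q i y"
    and inj: "\<And>y z. \<lbrakk>y \<in> \<Union>S; z \<in> \<Union>S; \<And>i. i \<in> I \<Longrightarrow> q i y = q i z\<rbrakk> \<Longrightarrow> y = z"
    and surj: "\<And>x. x \<in> topspace limit \<Longrightarrow> \<exists>y\<in>\<Union>S. \<forall>i\<in>I. q i y = x i"
    and base: "\<And>s y. \<lbrakk>s \<in> S; y \<in> s\<rbrakk> \<Longrightarrow>
      \<exists>i\<in>I. \<exists>U. openin (X i) U \<and> q i y \<in> U \<and> (\<forall>z\<in>\<Union>S. q i z \<in> U \<longrightarrow> z \<in> s)"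
  shows "is_projective_limit I le X p (topology_generated_by S) q"
proof -
  let ?Y = "topology_generated_by S" and ?h = "\<lambda>y. \<lambda>i\<in>I. q i y"
  have h: "continuous_map ?Y limit ?h"
    by (rule continuous_map_into_limit[OF cont]) (use compat in auto)
  have hS: "?h y \<in> topspace limit" if "y \<in> \<Union>S" for y
    using funcset_mem[OF continuous_map_funspace[OF h]] that by simp
  have h_inj: "inj_on ?h (\<Union>S)"
  proof (rule inj_onI)
    fix y z assume yz: "y \<in> \<Union>S" "z \<in> \<Union>S" "?h y = ?h z"
    have "q i y = q i z" if "i \<in> I" for i using fun_cong[OF yz(3), of i] that by simp
    then show "y = z" using inj yz(1,2) by blast
  qed
  have h_surj: "?h ` (\<Union>S) = topspace limit"
  proof (intro equalityI subsetI)
    fix x assume x: "x \<in> topspace limit"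
    from surj[OF this] obtain y where y: "y \<in> \<Union>S" "\<forall>i\<in>I. q i y = x i" by blast
    have "?h y = x" by (rule limit_eqI[OF hS[OF y(1)] x]) (use y(2) in simp)
    then show "x \<in> ?h ` (\<Union>S)" using y(1) by blast
  qed (use hS in blast)
  let ?g = "inv_into (\<Union>S) ?h"
  have hg: "?h (?g x) = x" "?g x \<in> \<Union>S" if "x \<in> topspace limit" for x
    using that h_surj f_inv_into_f[of x ?h "\<Union>S"] inv_into_into[of x ?h "\<Union>S"] by simp_all
  have g: "continuous_map limit ?Y ?g"
  proof (rule continuous_on_generated_topo)
    show "?g ` topspace limit \<subseteq> \<Union>S" using hg(2) by blast
    fix s assume s: "s \<in> S"
    show "openin limit (?g -` s \<inter> topspace limit)"
    proof (subst openin_subopen, intro ballI)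
      fix x assume x: "x \<in> ?g -` s \<inter> topspace limit"
      then obtain i U where iU: "i \<in> I" "openin (X i) U" "q i (?g x) \<in> U"
        "\<forall>z\<in>\<Union>S. q i z \<in> U \<longrightarrow> z \<in> s"
        using base[OF s, of "?g x"] by blast
      have q: "q i (?g y) = y i" if "y \<in> topspace limit" for y
        using fun_cong[OF hg(1)[OF that], of i] iU(1) by simp
      have "cylinder i U \<subseteq> ?g -` s \<inter> topspace limit"
      proof
        fix y assume y: "y \<in> cylinder i U"
        then have "q i (?g y) \<in> U" "?g y \<in> \<Union>S" using q hg(2) by simp_all
        then show "y \<in> ?g -` s \<inter> topspace limit" using iU(4) y by blast
      qed
      moreover have "x \<in> cylinder i U" using x q iU(3) by auto
      ultimately show "\<exists>T. openin limit T \<and> x \<in> T \<and> T \<subseteq> ?g -` s \<inter> topspace limit"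
        using cylinder_open[OF iU(1,2)] by blast
    qed
  qed
  have "homeomorphic_maps ?Y limit ?h ?g"
    unfolding homeomorphic_maps_def using h g hg(1) inv_into_f_f[OF h_inj] by simp
  then show ?thesis
    unfolding is_projective_limit_def homeomorphic_map_maps
    using projective_system_axioms by blast
qed

end

section \<open>A-valuations\<close>

lemma aval_eqI: "(a = A1 \<longleftrightarrow> b = A1) \<Longrightarrow> (a = A0 \<longleftrightarrow> b = A0) \<Longrightarrow> a = b"
  by (cases a; cases b) auto

lemma aval_leI: "(a = A1 \<Longrightarrow> b = A1) \<Longrightarrow> (b = A0 \<Longrightarrow> a = A0) \<Longrightarrow> a \<le> b"
  by (cases a; cases b) auto

lemma aval_leD: "a \<le> b \<Longrightarrow> a = A1 \<Longrightarrow> b = A1" "a \<le> b \<Longrightarrow> b = A0 \<Longrightarrow> a = A0"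
  by (cases a; cases b; simp)+

lemma SUP_aval_eq_A1: "(SUP U\<in>D. f U) = A1 \<longleftrightarrow> (\<exists>U\<in>D. f U = A1)"
proof -
  have "a \<le> A1" for a by (cases a) auto
  then have "(SUP U\<in>D. f U) = A1 \<longleftrightarrow> A1 \<in> f ` D" by (simp add: Sup_aval_def Max_eq_iff)
  then show ?thesis by (metis (full_types) image_iff)
qed

lemma SUP_aval_eq_A0: "(SUP U\<in>D. f U) = A0 \<longleftrightarrow> (\<forall>U\<in>D. f U = A0)"
proof -
  have "a \<le> A0 \<longleftrightarrow> a = A0" for a by (cases a) auto
  then show ?thesis by (auto simp: Sup_aval_def Max_eq_iff)
qed

lemma A_valuationsD:
  assumes "\<alpha> \<in> A_valuations T"
  shows "\<alpha> \<in> extensional {U. openin T U}"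
    and "openin T U \<Longrightarrow> openin T V \<Longrightarrow> U \<subseteq> V \<Longrightarrow> \<alpha> U \<le> \<alpha> V"
    and "directed_family D \<Longrightarrow> (\<And>U. U \<in> D \<Longrightarrow> openin T U) \<Longrightarrow> \<alpha> (\<Union>D) = (SUP U\<in>D. \<alpha> U)"
    and "\<alpha> {} = A0" and "\<alpha> (topspace T) = A1"
    and "openin T U \<Longrightarrow> openin T V \<Longrightarrow> \<alpha> U = A0 \<Longrightarrow> \<alpha> (U \<union> V) = \<alpha> V"
    and "openin T U \<Longrightarrow> openin T V \<Longrightarrow> \<alpha> V = A1 \<Longrightarrow> \<alpha> (U \<inter> V) = \<alpha> U"
proof -
  have s: "scott_continuous_on_opens T \<alpha>"
    and a: "\<forall>U V. openin T U \<and> openin T V \<and> \<alpha> U = A0 \<longrightarrow> \<alpha> (U \<union> V) = \<alpha> V"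
      "\<forall>U V. openin T U \<and> openin T V \<and> \<alpha> V = A1 \<longrightarrow> \<alpha> (U \<inter> V) = \<alpha> U"
    using assms unfolding A_valuations_def by blast+
  show "\<alpha> \<in> extensional {U. openin T U}" "\<alpha> {} = A0" "\<alpha> (topspace T) = A1"
    using assms unfolding A_valuations_def by blast+
  show "\<alpha> U \<le> \<alpha> V" if "openin T U" "openin T V" "U \<subseteq> V"
    using s that unfolding scott_continuous_on_opens_def by simp
  show "\<alpha> (\<Union>D) = (SUP U\<in>D. \<alpha> U)" if "directed_family D" "\<And>U. U \<in> D \<Longrightarrow> openin T U"
    using s that unfolding scott_continuous_on_opens_def by simp
  show "\<alpha> (U \<union> V) = \<alpha> V" if "openin T U" "openin T V" "\<alpha> U = A0" using a(1) that by simp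
  show "\<alpha> (U \<inter> V) = \<alpha> U" if "openin T U" "openin T V" "\<alpha> V = A1" using a(2) that by simp
qed

lemma topspace_A_valuation_space: "topspace (A_valuation_space T) = A_valuations T"
proof -
  have "A_valuations T = {\<alpha> \<in> A_valuations T. \<alpha> (topspace T) = A1}"
    using A_valuationsD(5) by blast
  then have "A_valuations T \<in> {{\<alpha> \<in> A_valuations T. \<alpha> U = A1} | U. openin T U}"
    using openin_topspace by blast
  then show ?thesis unfolding A_valuation_space_def by auto
qed

lemma openin_A_valuation_space:
  assumes "openin T U"
  shows "openin (A_valuation_space T) {\<alpha> \<in> A_valuations T. \<alpha> U = A1}"
    and "openin (A_valuation_space T) {\<alpha> \<in> A_valuations T. \<alpha> U \<noteq> A0}"
  unfolding A_valuation_space_def by (rule topology_generated_by_Basis; use assms in blast)+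

lemma A_valuation_map_apply:
  "openin S V \<Longrightarrow> A_valuation_map T S f \<alpha> V = \<alpha> {x \<in> topspace T. f x \<in> V}"
  unfolding A_valuation_map_def by simp

lemma A_valuation_map_in:
  assumes f: "continuous_map T S f" and \<alpha>: "\<alpha> \<in> A_valuations T"
  shows "A_valuation_map T S f \<alpha> \<in> A_valuations S"
proof -
  let ?pre = "\<lambda>V. {x \<in> topspace T. f x \<in> V}"
  note op = openin_continuous_map_preimage[OF f] and app = A_valuation_map_apply[of S]
  note \<alpha> = A_valuationsD[OF \<alpha>]
  have top: "?pre (topspace S) = topspace T" using continuous_map_funspace[OF f] by blast
  have Un: "?pre (U \<union> V) = ?pre U \<union> ?pre V" and Int: "?pre (U \<inter> V) = ?pre U \<inter> ?pre V" for U V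
    by blast+
  have "A_valuation_map T S f \<alpha> (\<Union>D) = (SUP U\<in>D. A_valuation_map T S f \<alpha> U)"
    if D: "directed_family D" "\<forall>U\<in>D. openin S U" for D
  proof -
    have "openin S (\<Union>D)" using D(2) by blast
    then have "A_valuation_map T S f \<alpha> (\<Union>D) = \<alpha> (?pre (\<Union>D))" by (rule app)
    also have "?pre (\<Union>D) = \<Union>(?pre ` D)" by blast
    also have "\<alpha> (\<Union>(?pre ` D)) = (SUP U\<in>?pre ` D. \<alpha> U)"
    proof (rule \<alpha>(3))
      show "directed_family (?pre ` D)" by (rule directed_family_image[OF D(1)]) blast
      show "openin T U" if "U \<in> ?pre ` D" for U using that op D(2) by blast
    qed
    also have "\<dots> = (SUP U\<in>D. A_valuation_map T S f \<alpha> U)"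
      unfolding image_image using D(2) by (intro SUP_cong) (simp_all add: A_valuation_map_apply)
    finally show ?thesis .
  qed
  moreover have "A_valuation_map T S f \<alpha> U \<le> A_valuation_map T S f \<alpha> V"
    if "openin S U" "openin S V" "U \<subseteq> V" for U V
    unfolding app[OF that(1)] app[OF that(2)] using that(3)
    by (intro \<alpha>(2) op that(1,2)) blast
  ultimately have "scott_continuous_on_opens S (A_valuation_map T S f \<alpha>)"
    unfolding scott_continuous_on_opens_def by blast
  moreover have "A_valuation_map T S f \<alpha> \<in> extensional {U. openin S U}"
    unfolding A_valuation_map_def by simp
  moreover have "A_valuation_map T S f \<alpha> {} = A0" "A_valuation_map T S f \<alpha> (topspace S) = A1"
    using \<alpha>(4,5) by (simp_all add: app top)
  moreover have "A_valuation_map T S f \<alpha> (U \<union> V) = A_valuation_map T S f \<alpha> V"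
    if "openin S U" "openin S V" "A_valuation_map T S f \<alpha> U = A0" for U V
    using \<alpha>(6)[OF op[OF that(1)] op[OF that(2)]] that(3)
    unfolding app[OF that(1)] app[OF that(2)] app[OF openin_Un[OF that(1,2)]] Un by blast
  moreover have "A_valuation_map T S f \<alpha> (U \<inter> V) = A_valuation_map T S f \<alpha> U"
    if "openin S U" "openin S V" "A_valuation_map T S f \<alpha> V = A1" for U V
    using \<alpha>(7)[OF op[OF that(1)] op[OF that(2)]] that(3)
    unfolding app[OF that(1)] app[OF that(2)] app[OF openin_Int[OF that(1,2)]] Int by blast
  ultimately show ?thesis unfolding A_valuations_def by blast
qed

lemma continuous_A_valuation_map:
  assumes f: "continuous_map T S f"
  shows "continuous_map (A_valuation_space T) (A_valuation_space S) (A_valuation_map T S f)"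
  unfolding A_valuation_space_def[of S]
proof (rule continuous_on_generated_topo, goal_cases)
  case (1 s)
  let ?m = "A_valuation_map T S f"
  have pre: "?m -` {\<beta> \<in> A_valuations S. \<beta> V = A1} \<inter> topspace (A_valuation_space T) =
      {\<alpha> \<in> A_valuations T. \<alpha> {x \<in> topspace T. f x \<in> V} = A1}"
    "?m -` {\<beta> \<in> A_valuations S. \<beta> V \<noteq> A0} \<inter> topspace (A_valuation_space T) =
      {\<alpha> \<in> A_valuations T. \<alpha> {x \<in> topspace T. f x \<in> V} \<noteq> A0}"
    if "openin S V" for V
    using A_valuation_map_in[OF f] A_valuation_map_apply[OF that, of T f]
    unfolding topspace_A_valuation_space by auto
  from 1 consider V where "openin S V" "s = {\<beta> \<in> A_valuations S. \<beta> V = A1}"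
    | V where "openin S V" "s = {\<beta> \<in> A_valuations S. \<beta> V \<noteq> A0}"
    by blast
  then show ?case
    using openin_A_valuation_space[OF openin_continuous_map_preimage[OF f]] pre by cases simp_all
next
  case 2
  have "\<Union>({{\<alpha> \<in> A_valuations S. \<alpha> U = A1} | U. openin S U} \<union>
      {{\<alpha> \<in> A_valuations S. \<alpha> U \<noteq> A0} | U. openin S U}) = A_valuations S"
    using topspace_A_valuation_space[of S] unfolding A_valuation_space_def by simp
  then show ?case using A_valuation_map_in[OF f] unfolding topspace_A_valuation_space by auto
qed

lemma A_valuation_filter:
  assumes \<alpha>: "\<alpha> \<in> A_valuations T"
  shows "scott_open_filterin T {U. openin T U \<and> \<alpha> U = A1}"
  unfolding scott_open_filterin_def
proof (intro conjI ballI allI impI)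
  let ?F = "{U. openin T U \<and> \<alpha> U = A1}"
  show "V \<in> ?F" if "U \<in> ?F \<and> openin T V \<and> U \<subseteq> V" for U V
    using that A_valuationsD(2)[OF \<alpha>, of U V] aval_leD(1) by blast
  show "U \<inter> V \<in> ?F" if "U \<in> ?F" "V \<in> ?F" for U V
    using that A_valuationsD(7)[OF \<alpha>, of U V] by (simp add: openin_Int)
  fix D assume D: "directed_family D \<and> (\<forall>U\<in>D. openin T U) \<and> \<Union>D \<in> ?F"
  then have "(SUP U\<in>D. \<alpha> U) = A1" using A_valuationsD(3)[OF \<alpha>, of D] by simp
  then show "\<exists>U\<in>D. U \<in> ?F" unfolding SUP_aval_eq_A1 using D by blast
qed blast

text \<open>The open null sets of an A-valuation form a directed family, so that there is a largest
  one.\<close>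

lemma A_valuation_support:
  assumes \<alpha>: "\<alpha> \<in> A_valuations T"
  obtains C where "closedin T C" "\<And>U. openin T U \<Longrightarrow> C \<inter> U \<noteq> {} \<longleftrightarrow> \<alpha> U \<noteq> A0"
proof -
  let ?D = "{U. openin T U \<and> \<alpha> U = A0}"
  let ?N = "\<Union>?D"
  have "directed_family ?D"
    unfolding directed_family_def
  proof (intro conjI ballI)
    show "?D \<noteq> {}" using A_valuationsD(4)[OF \<alpha>] by (auto intro: exI[of _ "{}"])
    fix U V assume "U \<in> ?D" "V \<in> ?D"
    then have "U \<union> V \<in> ?D" using A_valuationsD(6)[OF \<alpha>, of U V] by (simp add: openin_Un)
    then show "\<exists>W\<in>?D. U \<subseteq> W \<and> V \<subseteq> W" by blast
  qed
  then have "\<alpha> ?N = (SUP U\<in>?D. \<alpha> U)" by (rule A_valuationsD(3)[OF \<alpha>]) blast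
  also have "\<dots> = A0" unfolding SUP_aval_eq_A0 by blast
  finally have N: "\<alpha> ?N = A0" .
  have op: "openin T ?N" by blast
  show ?thesis
  proof (rule that[of "topspace T - ?N"])
    show "closedin T (topspace T - ?N)" using op by blast
    fix U assume U: "openin T U"
    have "\<alpha> U = A0 \<longleftrightarrow> U \<subseteq> ?N"
      using U N A_valuationsD(2)[OF \<alpha> U op] aval_leD(2) by blast
    then show "(topspace T - ?N) \<inter> U \<noteq> {} \<longleftrightarrow> \<alpha> U \<noteq> A0"
      using openin_subset[OF U] by blast
  qed
qed

section \<open>Quasi-lenses as A-valuations\<close>

text \<open>This puts the definition into the form of the axioms of an A-valuation. The first condition
  excludes that an open set has both the value \<open>A1\<close> and the value \<open>A0\<close>, and the other two are the laws
  for unions with null sets and intersections with sets of value \<open>A1\<close>. The complement of \<open>C\<close> is the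
  test set for the first two.\<close>

lemma quasi_lenses_iff:
  "(Q, C) \<in> quasi_lenses T \<longleftrightarrow>
     compact_saturatedin T Q \<and> closedin T C \<and>
     (\<forall>U. openin T U \<and> Q \<subseteq> U \<longrightarrow> C \<inter> U \<noteq> {}) \<and>
     (\<forall>U V. openin T U \<and> openin T V \<and> C \<inter> U = {} \<and> Q \<subseteq> U \<union> V \<longrightarrow> Q \<subseteq> V) \<and>
     (\<forall>U V. openin T U \<and> openin T V \<and> Q \<subseteq> V \<and> C \<inter> U \<noteq> {} \<longrightarrow> C \<inter> (U \<inter> V) \<noteq> {})"
proof (cases "compact_saturatedin T Q \<and> closedin T C")
  case True
  then have Q: "Q \<subseteq> topspace T" and C: "closedin T C" "C \<subseteq> topspace T" "openin T (topspace T - C)"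
    using closedin_subset[of T C] unfolding compact_saturatedin_def saturatedin_def by blast+
  have 1: "Q \<inter> C \<noteq> {} \<longleftrightarrow> (\<forall>U. openin T U \<and> Q \<subseteq> U \<longrightarrow> C \<inter> U \<noteq> {})"
    using Q C(3) by blast
  have 2: "Q \<subseteq> up_closure T (Q \<inter> C) \<longleftrightarrow>
      (\<forall>U V. openin T U \<and> openin T V \<and> C \<inter> U = {} \<and> Q \<subseteq> U \<union> V \<longrightarrow> Q \<subseteq> V)"
      (is "?L \<longleftrightarrow> ?R")
  proof
    show ?L if r: ?R
    proof (rule ccontr)
      assume "\<not> ?L"
      then obtain y where y: "y \<in> Q" "y \<notin> up_closure T (Q \<inter> C)" by blast
      let ?V = "\<Union>{V. openin T V \<and> y \<notin> V}"
      have "Q \<inter> C \<subseteq> ?V"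
        using y Q unfolding up_closure_def spec_le_def by blast
      then have "Q \<subseteq> (topspace T - C) \<union> ?V" using Q by blast
      moreover have "openin T ?V" by blast
      ultimately have "Q \<subseteq> ?V" using r C(3) by blast
      then show False using y(1) by blast
    qed
  next
    assume l: ?L
    show ?R
    proof (intro allI impI subsetI)
      fix U V x
      assume UV: "openin T U \<and> openin T V \<and> C \<inter> U = {} \<and> Q \<subseteq> U \<union> V" and "x \<in> Q"
      then obtain z where z: "z \<in> Q \<inter> C" "spec_le T z x" using l unfolding up_closure_def by blast
      then have "z \<in> V" using UV by blast
      then show "x \<in> V" using z(2) UV unfolding spec_le_def by blast
    qed
  qed
  have 3: "(\<forall>V. openin T V \<and> Q \<subseteq> V \<longrightarrow> C \<subseteq> T closure_of (V \<inter> C)) \<longleftrightarrow>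
      (\<forall>U V. openin T U \<and> openin T V \<and> Q \<subseteq> V \<and> C \<inter> U \<noteq> {} \<longrightarrow> C \<inter> (U \<inter> V) \<noteq> {})"
    (is "?L \<longleftrightarrow> ?R")
  proof
    assume l: ?L
    show ?R
    proof (intro allI impI)
      fix U V assume UV: "openin T U \<and> openin T V \<and> Q \<subseteq> V \<and> C \<inter> U \<noteq> {}"
      then obtain x where x: "x \<in> C" "x \<in> U" by blast
      have "C \<subseteq> T closure_of (V \<inter> C)" using l UV by blast
      then have "x \<in> T closure_of (V \<inter> C)" using x(1) by blast
      then show "C \<inter> (U \<inter> V) \<noteq> {}" using x(2) UV unfolding in_closure_of by blast
    qed
  next
    assume r: ?R
    show ?L
    proof (intro allI impI subsetI)
      fix V x assume V: "openin T V \<and> Q \<subseteq> V" and x: "x \<in> C"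
      have "\<exists>y. y \<in> V \<inter> C \<and> y \<in> U" if U: "x \<in> U \<and> openin T U" for U
      proof -
        have "C \<inter> (U \<inter> V) \<noteq> {}" using r U V x by blast
        then show ?thesis by blast
      qed
      then show "x \<in> T closure_of (V \<inter> C)" unfolding in_closure_of using x C(2) by blast
    qed
  qed
  show ?thesis unfolding quasi_lenses_def using True 1 2 3 by simp
qed (auto simp: quasi_lenses_def)

lemma quasi_lensesD:
  assumes "(Q, C) \<in> quasi_lenses T"
  shows "compact_saturatedin T Q" and "closedin T C"
    and "openin T U \<Longrightarrow> Q \<subseteq> U \<Longrightarrow> C \<inter> U \<noteq> {}"
    and "openin T U \<Longrightarrow> openin T V \<Longrightarrow> C \<inter> U = {} \<Longrightarrow> Q \<subseteq> U \<union> V \<Longrightarrow> Q \<subseteq> V"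
    and "openin T U \<Longrightarrow> openin T V \<Longrightarrow> Q \<subseteq> V \<Longrightarrow> C \<inter> U \<noteq> {} \<Longrightarrow> C \<inter> (U \<inter> V) \<noteq> {}"
proof -
  note a = assms[unfolded quasi_lenses_iff]
  show "compact_saturatedin T Q" "closedin T C" using a by blast+
  show "C \<inter> U \<noteq> {}" if "openin T U" "Q \<subseteq> U"
    using conjunct1[OF conjunct2[OF conjunct2[OF a]]] that by blast
  show "Q \<subseteq> V" if "openin T U" "openin T V" "C \<inter> U = {}" "Q \<subseteq> U \<union> V"
    using conjunct1[OF conjunct2[OF conjunct2[OF conjunct2[OF a]]], rule_format, of U V] that by simp
  show "C \<inter> (U \<inter> V) \<noteq> {}" if "openin T U" "openin T V" "Q \<subseteq> V" "C \<inter> U \<noteq> {}"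
    using conjunct2[OF conjunct2[OF conjunct2[OF conjunct2[OF a]]], rule_format, of U V] that by simp
qed

lemma quasi_lensesI:
  assumes "compactin T Q" "saturatedin T Q" "closedin T C"
    and "\<And>U. openin T U \<Longrightarrow> Q \<subseteq> U \<Longrightarrow> C \<inter> U \<noteq> {}"
    and "\<And>U V. \<lbrakk>openin T U; openin T V; C \<inter> U = {}; Q \<subseteq> U \<union> V\<rbrakk> \<Longrightarrow> Q \<subseteq> V"
    and "\<And>U V. \<lbrakk>openin T U; openin T V; Q \<subseteq> V; C \<inter> U \<noteq> {}\<rbrakk> \<Longrightarrow> C \<inter> (U \<inter> V) \<noteq> {}"
  shows "(Q, C) \<in> quasi_lenses T"
  unfolding quasi_lenses_iff compact_saturatedin_def
  using assms(1-3) by (intro conjI allI impI; (elim conjE)?) (assumption | (rule assms(4-6); assumption))+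

definition lens_valuation :: "'a topology \<Rightarrow> 'a set \<times> 'a set \<Rightarrow> 'a set \<Rightarrow> aval" where
  "lens_valuation T = (\<lambda>(Q, C). \<lambda>U\<in>{U. openin T U}.
     if Q \<subseteq> U then A1 else if C \<inter> U \<noteq> {} then AM else A0)"

lemma lens_valuation_eq_A1: "openin T U \<Longrightarrow> lens_valuation T (Q, C) U = A1 \<longleftrightarrow> Q \<subseteq> U"
  unfolding lens_valuation_def by simp

lemma lens_valuation_eq_A0:
  "(Q, C) \<in> quasi_lenses T \<Longrightarrow> openin T U \<Longrightarrow> lens_valuation T (Q, C) U = A0 \<longleftrightarrow> C \<inter> U = {}"
  by (auto simp: lens_valuation_def dest: quasi_lensesD(3))

lemma lens_valuation_in:
  assumes QC: "(Q, C) \<in> quasi_lenses T"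
  shows "lens_valuation T (Q, C) \<in> A_valuations T"
proof -
  let ?\<alpha> = "lens_valuation T (Q, C)"
  note A1 = lens_valuation_eq_A1[of T _ Q C] and A0 = lens_valuation_eq_A0[OF QC]
  have Q: "compactin T Q" "Q \<subseteq> topspace T"
    using quasi_lensesD(1)[OF QC] compactin_subset_topspace unfolding compact_saturatedin_def
    by blast+
  have "?\<alpha> (\<Union>D) = (SUP U\<in>D. ?\<alpha> U)" if D: "directed_family D" "\<forall>U\<in>D. openin T U" for D
  proof (rule aval_eqI)
    have op: "openin T (\<Union>D)" using D(2) by blast
    have "Q \<subseteq> \<Union>D \<longleftrightarrow> (\<exists>U\<in>D. Q \<subseteq> U)"
      using Q(1) D unfolding compactin_iff_directed_cover by blast
    then show "?\<alpha> (\<Union>D) = A1 \<longleftrightarrow> (SUP U\<in>D. ?\<alpha> U) = A1"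
      unfolding SUP_aval_eq_A1 using A1 op D(2) by simp
    have "C \<inter> \<Union>D = {} \<longleftrightarrow> (\<forall>U\<in>D. C \<inter> U = {})" by blast
    then show "?\<alpha> (\<Union>D) = A0 \<longleftrightarrow> (SUP U\<in>D. ?\<alpha> U) = A0"
      unfolding SUP_aval_eq_A0 using A0 op D(2) by simp
  qed
  moreover have "?\<alpha> U \<le> ?\<alpha> V" if "openin T U" "openin T V" "U \<subseteq> V" for U V
    using that by (intro aval_leI) (auto simp: A1 A0)
  ultimately have "scott_continuous_on_opens T ?\<alpha>" unfolding scott_continuous_on_opens_def by blast
  moreover have "?\<alpha> \<in> extensional {U. openin T U}" unfolding lens_valuation_def by simp
  moreover have "?\<alpha> {} = A0" "?\<alpha> (topspace T) = A1" using Q(2) by (simp_all add: A0 A1)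
  moreover have "?\<alpha> (U \<union> V) = ?\<alpha> V" if UV: "openin T U" "openin T V" "?\<alpha> U = A0" for U V
  proof (rule aval_eqI)
    have C: "C \<inter> U = {}" using UV A0 by blast
    show "?\<alpha> (U \<union> V) = A1 \<longleftrightarrow> ?\<alpha> V = A1"
      unfolding A1[OF UV(2)] A1[OF openin_Un[OF UV(1,2)]]
      using quasi_lensesD(4)[OF QC UV(1,2) C] by blast
    show "?\<alpha> (U \<union> V) = A0 \<longleftrightarrow> ?\<alpha> V = A0"
      unfolding A0[OF UV(2)] A0[OF openin_Un[OF UV(1,2)]] using C by blast
  qed
  moreover have "?\<alpha> (U \<inter> V) = ?\<alpha> U" if UV: "openin T U" "openin T V" "?\<alpha> V = A1" for U V
  proof (rule aval_eqI)
    have Q: "Q \<subseteq> V" using UV A1 by blast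
    show "?\<alpha> (U \<inter> V) = A1 \<longleftrightarrow> ?\<alpha> U = A1"
      unfolding A1[OF UV(1)] A1[OF openin_Int[OF UV(1,2)]] using Q by blast
    show "?\<alpha> (U \<inter> V) = A0 \<longleftrightarrow> ?\<alpha> U = A0"
      unfolding A0[OF UV(1)] A0[OF openin_Int[OF UV(1,2)]]
      using quasi_lensesD(5)[OF QC UV(1,2) Q] by blast
  qed
  ultimately show ?thesis unfolding A_valuations_def by blast
qed

text \<open>A saturated set is the intersection of its open neighbourhoods.\<close>

lemma saturatedin_subsetI:
  assumes A: "A \<subseteq> topspace T" and B: "saturatedin T B"
    and le: "\<And>U. openin T U \<Longrightarrow> B \<subseteq> U \<Longrightarrow> A \<subseteq> U"
  shows "A \<subseteq> B"
proof
  fix x assume x: "x \<in> A"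
  show "x \<in> B"
  proof (rule ccontr)
    assume n: "x \<notin> B"
    let ?U = "\<Union>{U. openin T U \<and> x \<notin> U}"
    have "B \<subseteq> ?U"
      using n x A B unfolding saturatedin_def spec_le_def by blast
    moreover have "openin T ?U" by blast
    ultimately have "A \<subseteq> ?U" using le by blast
    then show False using x by blast
  qed
qed

lemma inj_on_lens_valuation: "inj_on (lens_valuation T) (quasi_lenses T)"
proof (rule inj_onI, clarify)
  fix Q C Q' C' assume QC: "(Q, C) \<in> quasi_lenses T" and QC': "(Q', C') \<in> quasi_lenses T"
    and eq: "lens_valuation T (Q, C) = lens_valuation T (Q', C')"
  have Q: "Q \<subseteq> U \<longleftrightarrow> Q' \<subseteq> U" if "openin T U" for U
    using lens_valuation_eq_A1[OF that, of Q C] lens_valuation_eq_A1[OF that, of Q' C'] eq by simp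
  have C: "C \<inter> U = {} \<longleftrightarrow> C' \<inter> U = {}" if "openin T U" for U
    using lens_valuation_eq_A0[OF QC that] lens_valuation_eq_A0[OF QC' that] eq by simp
  have sat: "saturatedin T Q" "saturatedin T Q'" "Q \<subseteq> topspace T" "Q' \<subseteq> topspace T"
    using quasi_lensesD(1)[OF QC] quasi_lensesD(1)[OF QC']
    unfolding compact_saturatedin_def saturatedin_def by blast+
  have "Q = Q'"
  proof
    show "Q \<subseteq> Q'" by (rule saturatedin_subsetI[OF sat(3,2)]) (simp add: Q)
    show "Q' \<subseteq> Q" by (rule saturatedin_subsetI[OF sat(4,1)]) (simp add: Q)
  qed
  moreover have "C = C'"
  proof -
    have cl: "closedin T C" "closedin T C'" using quasi_lensesD(2) QC QC' by blast+
    then have "C' \<inter> (topspace T - C) = {}" "C \<inter> (topspace T - C') = {}"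
      using C[of "topspace T - C"] C[of "topspace T - C'"] by blast+
    then show ?thesis using closedin_subset[OF cl(1)] closedin_subset[OF cl(2)] by blast
  qed
  ultimately show "Q = Q' \<and> C = C'" by blast
qed

text \<open>The Hofmann--Mislove theorem is the construction of threads for a system with one space.\<close>

lemma hofmann_mislove:
  assumes sober: "sober_space T" and F: "scott_open_filterin T F" "F \<noteq> {}"
  obtains Q where "compact_saturatedin T Q" "\<And>U. openin T U \<Longrightarrow> Q \<subseteq> U \<longleftrightarrow> U \<in> F"
proof -
  interpret single: projective_system "{()}" "\<lambda>_ _. True" "\<lambda>_. T" "\<lambda>_ _ x. x"
    by unfold_locales (auto simp: reflp_on_def transp_on_def)
  have in_T: "{x \<in> topspace T. x \<in> U} = U" if "openin T U" for U
    using openin_subset[OF that] by blast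
  have sys: "single.filter_system (\<lambda>_. F)"
    unfolding single.filter_system_def using F in_T[OF scott_open_filterinD(1)[OF F(1)]] by simp
  define Q where "Q = {x \<in> topspace T. \<forall>U\<in>F. x \<in> U}"
  have Q: "Q \<subseteq> U \<longleftrightarrow> U \<in> F" if U: "openin T U" for U
  proof
    show "Q \<subseteq> U" if "U \<in> F" using that unfolding Q_def by blast
    show "U \<in> F" if sub: "Q \<subseteq> U"
    proof (rule ccontr)
      assume n: "U \<notin> F"
      have coh: "single.coherent_opens (\<lambda>_. U)"
        unfolding single.coherent_opens_def using U by auto
      have "\<And>i. i \<in> {()} \<Longrightarrow> (\<lambda>_. U) i \<notin> F" using n by simp
      from single.thread_avoiding[OF sober sys coh this]
      obtain x where x: "x \<in> topspace single.limit" "x () \<notin> U" "\<And>V. V \<in> F \<Longrightarrow> x () \<in> V"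
        by auto
      then have "x () \<in> Q" using single.limit_coord[OF x(1)] unfolding Q_def by simp
      then show False using sub x(2) by blast
    qed
  qed
  have "compactin T Q"
    unfolding compactin_iff_directed_cover
  proof (intro conjI allI impI)
    show "Q \<subseteq> topspace T" unfolding Q_def by blast
    fix D assume D: "directed_family D \<and> (\<forall>U\<in>D. openin T U) \<and> Q \<subseteq> \<Union>D"
    then have "\<Union>D \<in> F" using Q[of "\<Union>D"] by blast
    then obtain U where "U \<in> D" "U \<in> F" using scott_open_filterinD(4)[OF F(1), of D] D by blast
    then show "\<exists>U\<in>D. Q \<subseteq> U" using Q D by blast
  qed
  moreover have "saturatedin T Q"
    using scott_open_filterinD(1)[OF F(1)] unfolding Q_def saturatedin_def spec_le_def by blast
  ultimately show ?thesis using that Q unfolding compact_saturatedin_def by blast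
qed

lemma lens_valuation_surj:
  assumes sober: "sober_space T" and \<alpha>: "\<alpha> \<in> A_valuations T"
  shows "\<alpha> \<in> lens_valuation T ` quasi_lenses T"
proof -
  have "topspace T \<in> {U. openin T U \<and> \<alpha> U = A1}" using A_valuationsD(5)[OF \<alpha>] by simp
  then have "{U. openin T U \<and> \<alpha> U = A1} \<noteq> {}" by blast
  from hofmann_mislove[OF sober A_valuation_filter[OF \<alpha>] this]
  obtain Q where Qcs: "compact_saturatedin T Q"
    and Q': "\<And>U. openin T U \<Longrightarrow> Q \<subseteq> U \<longleftrightarrow> U \<in> {U. openin T U \<and> \<alpha> U = A1}"
    by blast
  have Q: "Q \<subseteq> U \<longleftrightarrow> \<alpha> U = A1" if "openin T U" for U using Q'[OF that] that by simp
  obtain C where C: "closedin T C" "\<And>U. openin T U \<Longrightarrow> C \<inter> U \<noteq> {} \<longleftrightarrow> \<alpha> U \<noteq> A0"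
    by (rule A_valuation_support[OF \<alpha>]) blast
  have QC: "(Q, C) \<in> quasi_lenses T"
    unfolding quasi_lenses_iff
  proof (intro conjI allI impI)
    show "C \<inter> U \<noteq> {}" if "openin T U \<and> Q \<subseteq> U" for U using that Q[of U] C(2)[of U] by simp
    show "Q \<subseteq> V" if "openin T U \<and> openin T V \<and> C \<inter> U = {} \<and> Q \<subseteq> U \<union> V" for U V
      using that C(2)[of U] Q[of V] Q[of "U \<union> V"] A_valuationsD(6)[OF \<alpha>, of U V] by auto
    show "C \<inter> (U \<inter> V) \<noteq> {}" if "openin T U \<and> openin T V \<and> Q \<subseteq> V \<and> C \<inter> U \<noteq> {}" for U V
      using that C(2)[of U] C(2)[of "U \<inter> V"] Q[of V] A_valuationsD(7)[OF \<alpha>, of U V] by auto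
  qed (use Qcs C(1) in blast)+
  have "lens_valuation T (Q, C) U = \<alpha> U" if U: "openin T U" for U
    using lens_valuation_eq_A1[OF U] lens_valuation_eq_A0[OF QC U] Q[OF U] C(2)[OF U]
    by (intro aval_eqI) simp_all
  then have "lens_valuation T (Q, C) = \<alpha>"
    using A_valuationsD(1)[OF \<alpha>] A_valuationsD(1)[OF lens_valuation_in[OF QC]]
    by (intro extensionalityI[where A = "{U. openin T U}"]) simp_all
  then show ?thesis using QC by blast
qed

lemma homeomorphic_map_topology_generated_by:
  assumes inj: "inj_on f (\<Union>S)"
  shows "homeomorphic_map (topology_generated_by S) (topology_generated_by ((`) f ` S)) f"
proof -
  let ?g = "inv_into (\<Union>S) f"
  have g: "?g (f x) = x" if "x \<in> \<Union>S" for x by (rule inv_into_f_f[OF inj that])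
  have "continuous_map (topology_generated_by S) (topology_generated_by ((`) f ` S)) f"
  proof (rule continuous_on_generated_topo)
    fix U assume "U \<in> (`) f ` S"
    then obtain s where s: "s \<in> S" "U = f ` s" by blast
    have "f -` U \<inter> topspace (topology_generated_by S) = s"
      using s inj unfolding inj_on_def by fastforce
    then show "openin (topology_generated_by S) (f -` U \<inter> topspace (topology_generated_by S))"
      using topology_generated_by_Basis[OF s(1)] by simp
  qed auto
  moreover have "continuous_map (topology_generated_by ((`) f ` S)) (topology_generated_by S) ?g"
  proof (rule continuous_on_generated_topo)
    fix s assume s: "s \<in> S"
    have "?g -` s \<inter> topspace (topology_generated_by ((`) f ` S)) = f ` s"
      using s g by fastforce
    moreover have "f ` s \<in> (`) f ` S" using s by blast
    ultimately show "openin (topology_generated_by ((`) f ` S))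
        (?g -` s \<inter> topspace (topology_generated_by ((`) f ` S)))"
      using topology_generated_by_Basis by simp
  next
    have "?g ` f ` \<Union>S \<subseteq> \<Union>S" using inv_into_into[of _ f "\<Union>S"] by blast
    then show "?g ` topspace (topology_generated_by ((`) f ` S)) \<subseteq> \<Union>S"
      by (simp add: image_Union)
  qed
  moreover have "\<forall>y\<in>\<Union>((`) f ` S). f (?g y) = y"
    unfolding image_Union[symmetric] using f_inv_into_f[of _ f "\<Union>S"] by blast
  ultimately have "homeomorphic_maps (topology_generated_by S)
      (topology_generated_by ((`) f ` S)) f ?g"
    unfolding homeomorphic_maps_def topology_generated_by_topspace using g by blast
  then show ?thesis unfolding homeomorphic_map_maps by blast
qed

lemma topspace_quasi_lens_space: "topspace (quasi_lens_space T) = quasi_lenses T"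
proof -
  have "Q \<subseteq> topspace T" if "(Q, C) \<in> quasi_lenses T" for Q C
    using quasi_lensesD(1)[OF that] unfolding compact_saturatedin_def saturatedin_def by blast
  then have "quasi_lenses T = {(Q, C) \<in> quasi_lenses T. Q \<subseteq> topspace T}" by blast
  then have "quasi_lenses T \<in> {{(Q, C) \<in> quasi_lenses T. Q \<subseteq> U} | U. openin T U}"
    using openin_topspace by blast
  then show ?thesis unfolding quasi_lens_space_def by auto
qed

lemma homeomorphic_map_lens_valuation:
  assumes sober: "sober_space T"
  shows "homeomorphic_map (quasi_lens_space T) (A_valuation_space T) (lens_valuation T)"
proof -
  let ?S1 = "{{(Q, C) \<in> quasi_lenses T. Q \<subseteq> U} | U. openin T U}"
  let ?S2 = "{{(Q, C) \<in> quasi_lenses T. C \<inter> U \<noteq> {}} | U. openin T U}"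
  have image: "lens_valuation T ` quasi_lenses T = A_valuations T"
    using lens_valuation_in lens_valuation_surj[OF sober] by fast
  have image_family: "(`) (lens_valuation T) ` {f U | U. openin T U} = {g U | U. openin T U}"
    if "\<And>U. openin T U \<Longrightarrow> lens_valuation T ` f U = g U" for f g
    unfolding setcompr_eq_image image_image by (rule image_cong) (simp_all add: that)
  have "lens_valuation T ` {(Q, C) \<in> quasi_lenses T. Q \<subseteq> U} = {\<alpha> \<in> A_valuations T. \<alpha> U = A1}"
    if "openin T U" for U
    unfolding image[symmetric] using lens_valuation_eq_A1[OF that] by fastforce
  then have 1: "(`) (lens_valuation T) ` ?S1 = {{\<alpha> \<in> A_valuations T. \<alpha> U = A1} | U. openin T U}"
    by (rule image_family)
  have "lens_valuation T ` {(Q, C) \<in> quasi_lenses T. C \<inter> U \<noteq> {}} = {\<alpha> \<in> A_valuations T. \<alpha> U \<noteq> A0}"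
    if "openin T U" for U
    unfolding image[symmetric] using lens_valuation_eq_A0[OF _ that] by fastforce
  then have 2: "(`) (lens_valuation T) ` ?S2 = {{\<alpha> \<in> A_valuations T. \<alpha> U \<noteq> A0} | U. openin T U}"
    by (rule image_family)
  have "inj_on (lens_valuation T) (\<Union>(?S1 \<union> ?S2))"
    by (rule inj_on_subset[OF inj_on_lens_valuation]) blast
  from homeomorphic_map_topology_generated_by[OF this] show ?thesis
    unfolding quasi_lens_space_def A_valuation_space_def image_Un 1 2 .
qed

lemma quasi_lens_map_natural:
  assumes f: "continuous_map T S f" and QC: "(Q, C) \<in> quasi_lenses T"
  shows "quasi_lens_map S f (Q, C) \<in> quasi_lenses S"
    and "lens_valuation S (quasi_lens_map S f (Q, C)) = A_valuation_map T S f (lens_valuation T (Q, C))"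
proof -
  let ?pre = "\<lambda>V. {x \<in> topspace T. f x \<in> V}"
  let ?Q = "up_closure S (f ` Q)" and ?C = "S closure_of (f ` C)"
  note op = openin_continuous_map_preimage[OF f]
  have cQ: "compactin T Q" using quasi_lensesD(1)[OF QC] unfolding compact_saturatedin_def by blast
  have fQ: "compactin S (f ` Q)" by (rule image_compactin[OF cQ f])
  have sub: "Q \<subseteq> topspace T" "C \<subseteq> topspace T"
    using compactin_subset_topspace[OF cQ] closedin_subset[OF quasi_lensesD(2)[OF QC]] .
  have Q: "?Q \<subseteq> V \<longleftrightarrow> Q \<subseteq> ?pre V" if "openin S V" for V
    using up_closure_subset_open_iff[OF that compactin_subset_topspace[OF fQ]] sub(1) by blast
  have C: "?C \<inter> V = {} \<longleftrightarrow> C \<inter> ?pre V = {}" if "openin S V" for V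
    using openin_Int_closure_of_eq_empty[OF that, of "f ` C"] sub(2) by blast
  have Un: "?pre (U \<union> V) = ?pre U \<union> ?pre V" and Int: "?pre (U \<inter> V) = ?pre U \<inter> ?pre V" for U V
    by blast+
  have lens: "(?Q, ?C) \<in> quasi_lenses S"
    unfolding quasi_lenses_iff
  proof (intro conjI allI impI)
    show "compact_saturatedin S ?Q" by (rule compact_saturatedin_up_closure[OF fQ])
    show "closedin S ?C" by simp
    show "?C \<inter> U \<noteq> {}" if "openin S U \<and> ?Q \<subseteq> U" for U
      using that Q[of U] C[of U] quasi_lensesD(3)[OF QC op, of U] by blast
    show "?Q \<subseteq> V" if "openin S U \<and> openin S V \<and> ?C \<inter> U = {} \<and> ?Q \<subseteq> U \<union> V" for U V
      using that Q[of V] Q[of "U \<union> V"] C[of U] quasi_lensesD(4)[OF QC op op, of U V]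
      unfolding Un by auto
    show "?C \<inter> (U \<inter> V) \<noteq> {}" if "openin S U \<and> openin S V \<and> ?Q \<subseteq> V \<and> ?C \<inter> U \<noteq> {}" for U V
      using that Q[of V] C[of U] C[of "U \<inter> V"] quasi_lensesD(5)[OF QC op op, of U V]
      unfolding Int by auto
  qed
  then show "quasi_lens_map S f (Q, C) \<in> quasi_lenses S" unfolding quasi_lens_map_def by simp
  have "lens_valuation S (?Q, ?C) V = A_valuation_map T S f (lens_valuation T (Q, C)) V"
    if V: "openin S V" for V
    unfolding A_valuation_map_apply[OF V]
    by (intro aval_eqI)
      (simp_all only: lens_valuation_eq_A1[OF V] lens_valuation_eq_A1[OF op[OF V]]
        lens_valuation_eq_A0[OF lens V] lens_valuation_eq_A0[OF QC op[OF V]] Q[OF V] C[OF V])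
  then have "lens_valuation S (?Q, ?C) = A_valuation_map T S f (lens_valuation T (Q, C))"
    using A_valuationsD(1)[OF lens_valuation_in[OF lens]]
      A_valuationsD(1)[OF A_valuation_map_in[OF f lens_valuation_in[OF QC]]]
    by (intro extensionalityI[where A = "{U. openin S U}"]) simp_all
  then show "lens_valuation S (quasi_lens_map S f (Q, C)) =
      A_valuation_map T S f (lens_valuation T (Q, C))"
    unfolding quasi_lens_map_def by simp
qed

section \<open>Limits of A-valuations\<close>

context projective_system
begin

lemma A_valuation_projective_system:
  "projective_system I le (\<lambda>i. A_valuation_space (X i)) (\<lambda>i j. A_valuation_map (X j) (X i) (p i j))"
proof (rule projective_system.intro)
  show "reflp_on I le" "transp_on I le" "I \<noteq> {}" by (rule index_refl index_trans index_nonempty)+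
  show "\<exists>k\<in>I. le i k \<and> le j k" if "i \<in> I" "j \<in> I" for i j by (rule index_directed[OF that])
  show "continuous_map (A_valuation_space (X j)) (A_valuation_space (X i))
      (A_valuation_map (X j) (X i) (p i j))" if "i \<in> I" "j \<in> I" "le i j" for i j
    by (rule continuous_A_valuation_map[OF bonding_continuous[OF that]])
  show "A_valuation_map (X i) (X i) (p i i) \<alpha> = \<alpha>"
    if i: "i \<in> I" and \<alpha>: "\<alpha> \<in> topspace (A_valuation_space (X i))" for i \<alpha>
  proof (rule extensionalityI[where A = "{U. openin (X i) U}"])
    show "\<alpha> \<in> extensional {U. openin (X i) U}"
      using \<alpha> A_valuationsD(1) unfolding topspace_A_valuation_space by blast
    show "A_valuation_map (X i) (X i) (p i i) \<alpha> U = \<alpha> U" if "U \<in> {U. openin (X i) U}" for U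
      using that pull_refl[OF i openin_subset] by (simp add: A_valuation_map_apply)
  qed (simp add: A_valuation_map_def)
  show "A_valuation_map (X j) (X i) (p i j) (A_valuation_map (X k) (X j) (p j k) \<alpha>) =
      A_valuation_map (X k) (X i) (p i k) \<alpha>"
    if ijk: "i \<in> I" "j \<in> I" "k \<in> I" "le i j" "le j k" for i j k \<alpha>
  proof (rule extensionalityI[where A = "{U. openin (X i) U}"])
    fix U assume "U \<in> {U. openin (X i) U}"
    then have U: "openin (X i) U" by simp
    show "A_valuation_map (X j) (X i) (p i j) (A_valuation_map (X k) (X j) (p j k) \<alpha>) U =
        A_valuation_map (X k) (X i) (p i k) \<alpha> U"
      unfolding A_valuation_map_apply[OF U]
        A_valuation_map_apply[OF pull_open[OF ijk(1,2,4) U]] pull_pull[OF ijk] ..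
  qed (simp_all add: A_valuation_map_def)
qed

lemma coherent_core: "coherent_opens (\<lambda>i. core i W)"
  unfolding coherent_opens_def using core_open pull_core by blast

text \<open>An open set of the limit is the directed union of the cylinders over its cores, so that
  Scott continuity determines a valuation by its values on cylinders.\<close>

lemma A_valuation_limit_cores:
  assumes \<beta>: "\<beta> \<in> A_valuations limit" and W: "openin limit W"
  shows "\<beta> W = (SUP i\<in>I. \<beta> (cylinder i (core i W)))"
proof -
  have "W = (\<Union>i\<in>I. cylinder i (core i W))"
  proof
    show "W \<subseteq> (\<Union>i\<in>I. cylinder i (core i W))"
      using in_core[OF W] openin_subset[OF W] by blast
    show "(\<Union>i\<in>I. cylinder i (core i W)) \<subseteq> W"
      using cylinder_core by blast
  qed
  then have "\<beta> W = \<beta> (\<Union>i\<in>I. cylinder i (core i W))" by simp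
  also have "\<dots> = (SUP U\<in>(\<lambda>i. cylinder i (core i W)) ` I. \<beta> U)"
    by (rule A_valuationsD(3)[OF \<beta> directed_family_cylinders[OF coherent_core]])
      (use cylinder_open core_open in auto)
  finally show ?thesis unfolding image_image .
qed

text \<open>The hypothesis on closed sets makes the limit of the supports large enough, while the filters of
  open sets of value \<open>A1\<close> have a large enough limit in every system of sober spaces. The two limit
  sets form a quasi-lens, because each condition involves finitely many open sets and compactness of
  \<open>Q\<close> reduces it to the axioms for \<open>\<alpha> i\<close> at one index. This quasi-lens induces the wanted
  valuation.\<close>

lemma A_valuation_thread_realised:
  assumes sober: "\<And>i. i \<in> I \<Longrightarrow> sober_space (X i)"
    and closed_threads: "\<And>C i U. \<lbrakk>closed_system C; i \<in> I; openin (X i) U; C i \<inter> U \<noteq> {}\<rbrakk>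
      \<Longrightarrow> \<exists>x\<in>topspace limit. x i \<in> U \<and> (\<forall>j\<in>I. x j \<in> C j)"
    and \<alpha>: "\<And>i. i \<in> I \<Longrightarrow> \<alpha> i \<in> A_valuations (X i)"
    and compat: "\<And>i j U. \<lbrakk>i \<in> I; j \<in> I; le i j; openin (X i) U\<rbrakk> \<Longrightarrow> \<alpha> j (pull i j U) = \<alpha> i U"
  shows "\<exists>\<beta>\<in>A_valuations limit. \<forall>i\<in>I. \<forall>U. openin (X i) U \<longrightarrow> \<beta> (cylinder i U) = \<alpha> i U"
proof -
  define F where "F i = {U. openin (X i) U \<and> \<alpha> i U = A1}" for i
  have F: "filter_system F"
    unfolding filter_system_def
  proof (intro conjI ballI allI impI)
    show "scott_open_filterin (X i) (F i)" if "i \<in> I" for i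
      unfolding F_def by (rule A_valuation_filter[OF \<alpha>[OF that]])
    show "pull i j U \<in> F j" if "i \<in> I" "j \<in> I" "le i j \<and> U \<in> F i" for i j U
      using that compat pull_open unfolding F_def by simp
    obtain i where i: "i \<in> I" using index_nonempty by blast
    have "topspace (X i) \<in> F i" unfolding F_def using A_valuationsD(5)[OF \<alpha>[OF i]] by simp
    then show "\<exists>i\<in>I. F i \<noteq> {}" using i by blast
  qed
  have "\<exists>C. closedin (X i) C \<and> (\<forall>U. openin (X i) U \<longrightarrow> (C \<inter> U \<noteq> {} \<longleftrightarrow> \<alpha> i U \<noteq> A0))"
    if i: "i \<in> I" for i
  proof -
    obtain C where "closedin (X i) C" "\<And>U. openin (X i) U \<Longrightarrow> C \<inter> U \<noteq> {} \<longleftrightarrow> \<alpha> i U \<noteq> A0"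
      by (rule A_valuation_support[OF \<alpha>[OF i]]) blast
    then show ?thesis by (intro exI[of _ C] conjI allI impI)
  qed
  then have "\<exists>C. \<forall>i\<in>I. closedin (X i) (C i) \<and>
      (\<forall>U. openin (X i) U \<longrightarrow> (C i \<inter> U \<noteq> {} \<longleftrightarrow> \<alpha> i U \<noteq> A0))"
    by (intro bchoice ballI)
  then obtain C where "\<forall>i\<in>I. closedin (X i) (C i) \<and>
      (\<forall>U. openin (X i) U \<longrightarrow> (C i \<inter> U \<noteq> {} \<longleftrightarrow> \<alpha> i U \<noteq> A0))"
    by (rule exE)
  then have C: "closedin (X i) (C i)" "openin (X i) U \<Longrightarrow> C i \<inter> U \<noteq> {} \<longleftrightarrow> \<alpha> i U \<noteq> A0"
    if "i \<in> I" for i U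
    using that by simp_all
  have Csys: "closed_system C"
    unfolding closed_system_def
  proof (intro conjI ballI allI impI)
    fix i j U assume ij: "i \<in> I" "j \<in> I" and U: "le i j \<and> openin (X i) U"
    show "C i \<inter> U \<noteq> {} \<longleftrightarrow> C j \<inter> pull i j U \<noteq> {}"
      using C(2)[OF ij(1), of U] C(2)[OF ij(2) pull_open[OF ij, of U]] compat[OF ij, of U] U by simp
  qed (rule C(1))
  define Q where "Q = {x \<in> topspace limit. \<forall>i\<in>I. \<forall>U\<in>F i. x i \<in> U}"
  define K where "K = {x \<in> topspace limit. \<forall>i\<in>I. x i \<in> C i}"
  have K_cyl: "K \<inter> cylinder i U \<noteq> {} \<longleftrightarrow> \<alpha> i U \<noteq> A0" if i: "i \<in> I" and U: "openin (X i) U" for i U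
  proof
    assume "K \<inter> cylinder i U \<noteq> {}"
    then have "C i \<inter> U \<noteq> {}" unfolding K_def using i by blast
    then show "\<alpha> i U \<noteq> A0" using C(2)[OF i U] by simp
  next
    assume "\<alpha> i U \<noteq> A0"
    then have "C i \<inter> U \<noteq> {}" using C(2)[OF i U] by simp
    from closed_threads[OF Csys i U this] show "K \<inter> cylinder i U \<noteq> {}" unfolding K_def by blast
  qed
  have Q_cover: "\<exists>W\<in>D. \<exists>i\<in>I. \<exists>U\<in>F i. cylinder i U \<subseteq> W"
    if D: "directed_family D" "\<And>W. W \<in> D \<Longrightarrow> openin limit W" "Q \<subseteq> \<Union>D" for D
  proof -
    from filter_limit_cover[OF sober F D(1,2) D(3)[unfolded Q_def]]
    obtain W i U where "W \<in> D" "i \<in> I" "U \<in> F i" "cylinder i U \<subseteq> W" by blast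
    then show ?thesis by (intro bexI)
  qed
  have Q_sub: "Q \<subseteq> cylinder i U" if "i \<in> I" "U \<in> F i" for i U
    using that unfolding Q_def by blast
  have Q_directed: "\<exists>W\<in>D. Q \<subseteq> W"
    if D: "directed_family D" "\<And>W. W \<in> D \<Longrightarrow> openin limit W" "Q \<subseteq> \<Union>D" for D
  proof -
    obtain W where W: "W \<in> D" "\<exists>i\<in>I. \<exists>U\<in>F i. cylinder i U \<subseteq> W" using Q_cover[OF D] by (rule bexE)
    then show ?thesis using Q_sub by blast
  qed
  have Q_open: "\<exists>i\<in>I. \<exists>U\<in>F i. cylinder i U \<subseteq> W" if W: "openin limit W" "Q \<subseteq> W" for W
    using Q_cover[of "{W}"] W unfolding directed_family_def by simp
  have Q_cyl: "Q \<subseteq> cylinder i U \<longleftrightarrow> \<alpha> i U = A1" if i: "i \<in> I" and U: "openin (X i) U" for i U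
  proof
    show "Q \<subseteq> cylinder i U" if "\<alpha> i U = A1" using Q_sub[OF i] U that unfolding F_def by simp
    show "\<alpha> i U = A1" if sub: "Q \<subseteq> cylinder i U"
    proof (rule ccontr)
      assume n: "\<alpha> i U \<noteq> A1"
      \<comment> \<open>By compatibility, the family generated by \<open>U\<close> stays outside the filters.\<close>
      let ?V = "\<lambda>j. if le i j then pull i j U else {}"
      have "?V j \<notin> F j" if j: "j \<in> I" for j
        using compat[OF i j _ U] n A_valuationsD(4)[OF \<alpha>[OF j]] unfolding F_def by simp
      from thread_avoiding[OF sober F coherent_opens_from[OF i U] this]
      obtain x where x: "x \<in> topspace limit" "\<And>j. j \<in> I \<Longrightarrow> x j \<notin> ?V j"
        "\<And>j V. j \<in> I \<Longrightarrow> V \<in> F j \<Longrightarrow> x j \<in> V"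
        by blast
      have "x \<in> Q" unfolding Q_def using x(1,3) by simp
      then have "x i \<in> U" using sub by blast
      then show False
        using x(2)[OF i] le_refl[OF i] pull_refl[OF i openin_subset[OF U]] by simp
    qed
  qed
  have "compactin limit Q"
    unfolding compactin_iff_directed_cover
  proof (intro conjI allI impI)
    show "Q \<subseteq> topspace limit" unfolding Q_def by blast
    fix D assume D: "directed_family D \<and> (\<forall>U\<in>D. openin limit U) \<and> Q \<subseteq> \<Union>D"
    then show "\<exists>W\<in>D. Q \<subseteq> W" by (intro Q_directed) simp_all
  qed
  moreover have "saturatedin limit Q"
    unfolding saturatedin_def
  proof (intro conjI allI impI)
    show "Q \<subseteq> topspace limit" unfolding Q_def by blast
    fix x y assume xy: "x \<in> Q \<and> spec_le limit x y"
    have "y i \<in> U" if i: "i \<in> I" and U: "U \<in> F i" for i U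
    proof -
      have "openin limit (cylinder i U)" using cylinder_open[OF i] U unfolding F_def by blast
      moreover have "x \<in> cylinder i U" using Q_sub[OF i U] xy by blast
      ultimately have "y \<in> cylinder i U" using xy unfolding spec_le_def by blast
      then show ?thesis by blast
    qed
    then show "y \<in> Q" using xy unfolding Q_def spec_le_def by blast
  qed
  moreover have "closedin limit K"
  proof -
    have "K = (\<Inter>i\<in>I. cylinder i (C i))" unfolding K_def using index_nonempty by blast
    moreover have "closedin limit (cylinder i (C i))" if "i \<in> I" for i
      by (rule closedin_continuous_map_preimage[OF continuous_map_coord[OF that] C(1)[OF that]])
    ultimately show ?thesis using index_nonempty closedin_INT[of I limit] by auto
  qed
  moreover have "K \<inter> W \<noteq> {}" if W: "openin limit W" "Q \<subseteq> W" for W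
  proof -
    obtain i U where i: "i \<in> I" "U \<in> F i" "cylinder i U \<subseteq> W" using Q_open[OF W] by blast
    then have "K \<inter> cylinder i U \<noteq> {}" using K_cyl[OF i(1), of U] unfolding F_def by simp
    then show ?thesis using i(3) by blast
  qed
  moreover have "Q \<subseteq> B"
    if A: "openin limit A" and B: "openin limit B" and disj: "K \<inter> A = {}" and sub: "Q \<subseteq> A \<union> B" for A B
  proof -
    let ?V = "\<lambda>i. core i A \<union> core i B"
    let ?D = "(\<lambda>i. cylinder i (?V i)) ` I"
    have op: "openin (X i) (?V i)" for i using core_open by blast
    have "directed_family ?D"
      by (rule directed_family_cylinders[OF coherent_opens_union[OF coherent_core coherent_core]])
    moreover have "openin limit W" if "W \<in> ?D" for W using that cylinder_open op by blast
    moreover have "Q \<subseteq> \<Union>?D"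
    proof
      fix x assume x: "x \<in> Q"
      then have "\<exists>i\<in>I. x i \<in> ?V i" using sub in_core[OF A] in_core[OF B] by blast
      then show "x \<in> \<Union>?D" using x unfolding Q_def by blast
    qed
    ultimately have "\<exists>W\<in>?D. Q \<subseteq> W" by (rule Q_directed)
    then obtain i where i: "i \<in> I" "Q \<subseteq> cylinder i (?V i)" by (rule bexE) (erule imageE, simp)
    then have "\<alpha> i (?V i) = A1" using Q_cyl[OF i(1) op] by blast
    moreover have "\<alpha> i (core i A) = A0"
      using K_cyl[OF i(1) core_open, of A] cylinder_core[of i A] disj by blast
    ultimately have "\<alpha> i (core i B) = A1"
      using A_valuationsD(6)[OF \<alpha>[OF i(1)] core_open core_open] by simp
    then have "Q \<subseteq> cylinder i (core i B)" using Q_cyl[OF i(1) core_open] by simp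
    then show ?thesis using cylinder_core[of i B] by blast
  qed
  moreover have "K \<inter> (A \<inter> B) \<noteq> {}"
    if A: "openin limit A" and B: "openin limit B" and sub: "Q \<subseteq> B" and meet: "K \<inter> A \<noteq> {}" for A B
  proof -
    obtain i U where i: "i \<in> I" "U \<in> F i" "cylinder i U \<subseteq> B" using Q_open[OF B sub] by blast
    obtain x where x: "x \<in> K" "x \<in> A" using meet by blast
    obtain j where j: "j \<in> I" "x j \<in> core j A" using in_core[OF A x(2)] by blast
    obtain k where k: "k \<in> I" "le i k" "le j k" using index_directed i(1) j(1) by blast
    let ?A = "pull j k (core j A)" and ?B = "pull i k U"
    have U: "openin (X i) U" using i(2) unfolding F_def by blast
    have op: "openin (X k) ?A" "openin (X k) ?B"
      by (rule pull_open[OF j(1) k(1,3) core_open] pull_open[OF i(1) k(1,2) U])+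
    have cyl: "cylinder k ?A = cylinder j (core j A)" "cylinder k ?B = cylinder i U"
      by (rule cylinder_pull[OF j(1) k(1,3)] cylinder_pull[OF i(1) k(1,2)])+
    have "x \<in> K \<inter> cylinder k ?A" unfolding cyl using x(1) j(2) unfolding K_def by blast
    then have "\<alpha> k ?A \<noteq> A0" using K_cyl[OF k(1) op(1)] by blast
    moreover have "?B \<in> F k" by (rule filter_systemD(2)[OF F i(1) k(1,2) i(2)])
    then have "\<alpha> k ?B = A1" unfolding F_def by blast
    ultimately have "\<alpha> k (?A \<inter> ?B) \<noteq> A0"
      using A_valuationsD(7)[OF \<alpha>[OF k(1)] op] by simp
    then have "K \<inter> cylinder k (?A \<inter> ?B) \<noteq> {}" using K_cyl[OF k(1) openin_Int[OF op]] by blast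
    moreover have "cylinder k (?A \<inter> ?B) = cylinder k ?A \<inter> cylinder k ?B" by blast
    ultimately show ?thesis unfolding cyl using cylinder_core[of j A] i(3) by blast
  qed
  ultimately have lens: "(Q, K) \<in> quasi_lenses limit"
    by (rule quasi_lensesI)
  have "lens_valuation limit (Q, K) (cylinder i U) = \<alpha> i U"
    if i: "i \<in> I" and U: "openin (X i) U" for i U
  proof (rule aval_eqI)
    note op = cylinder_open[OF i U]
    show "lens_valuation limit (Q, K) (cylinder i U) = A1 \<longleftrightarrow> \<alpha> i U = A1"
      unfolding lens_valuation_eq_A1[OF op] by (rule Q_cyl[OF i U])
    show "lens_valuation limit (Q, K) (cylinder i U) = A0 \<longleftrightarrow> \<alpha> i U = A0"
      unfolding lens_valuation_eq_A0[OF lens op] using K_cyl[OF i U] by blast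
  qed
  then show ?thesis using lens_valuation_in[OF lens] by blast
qed

lemma A_valuation_limit:
  assumes sober: "\<And>i. i \<in> I \<Longrightarrow> sober_space (X i)"
    and closed_threads: "\<And>C i U. \<lbrakk>closed_system C; i \<in> I; openin (X i) U; C i \<inter> U \<noteq> {}\<rbrakk>
      \<Longrightarrow> \<exists>x\<in>topspace limit. x i \<in> U \<and> (\<forall>j\<in>I. x j \<in> C j)"
  shows "is_projective_limit I le (\<lambda>i. A_valuation_space (X i))
    (\<lambda>i j. A_valuation_map (X j) (X i) (p i j)) (A_valuation_space limit)
    (\<lambda>i. A_valuation_map limit (X i) (\<lambda>x. x i))"
proof -
  interpret A: projective_system I le "\<lambda>i. A_valuation_space (X i)"
    "\<lambda>i j. A_valuation_map (X j) (X i) (p i j)"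
    by (rule A_valuation_projective_system)
  let ?S = "{{\<alpha> \<in> A_valuations limit. \<alpha> U = A1} | U. openin limit U} \<union>
    {{\<alpha> \<in> A_valuations limit. \<alpha> U \<noteq> A0} | U. openin limit U}"
  let ?q = "\<lambda>i. A_valuation_map limit (X i) (\<lambda>x. x i)"
  have S: "\<Union>?S = A_valuations limit"
    using topspace_A_valuation_space[of limit] unfolding A_valuation_space_def by simp
  have q: "?q i \<beta> U = \<beta> (cylinder i U)" if "openin (X i) U" for i \<beta> U
    by (rule A_valuation_map_apply[OF that])
  have q_in: "?q i \<beta> \<in> A_valuations (X i)" if "i \<in> I" "\<beta> \<in> A_valuations limit" for i \<beta>
    by (rule A_valuation_map_in[OF continuous_map_coord[OF that(1)] that(2)])
  show ?thesis
    unfolding A_valuation_space_def[of limit]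
  proof (rule A.is_projective_limitI, unfold S)
    show "continuous_map (topology_generated_by ?S) (A_valuation_space (X i)) (?q i)"
      if "i \<in> I" for i
      using continuous_A_valuation_map[OF continuous_map_coord[OF that]]
      unfolding A_valuation_space_def[of limit] .
  next
    fix i j \<beta> assume ij: "i \<in> I" "j \<in> I" "le i j" and \<beta>: "\<beta> \<in> A_valuations limit"
    show "A_valuation_map (X j) (X i) (p i j) (?q j \<beta>) = ?q i \<beta>"
    proof (rule extensionalityI[where A = "{U. openin (X i) U}"])
      fix U assume "U \<in> {U. openin (X i) U}"
      then have U: "openin (X i) U" by simp
      show "A_valuation_map (X j) (X i) (p i j) (?q j \<beta>) U = ?q i \<beta> U"
        unfolding A_valuation_map_apply[OF U] q[OF pull_open[OF ij U]] cylinder_pull[OF ij] ..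
    qed (simp_all add: A_valuation_map_def)
  next
    fix \<beta> \<gamma> assume \<beta>: "\<beta> \<in> A_valuations limit" and \<gamma>: "\<gamma> \<in> A_valuations limit"
      and eq: "\<And>i. i \<in> I \<Longrightarrow> ?q i \<beta> = ?q i \<gamma>"
    show "\<beta> = \<gamma>"
    proof (rule extensionalityI[OF A_valuationsD(1)[OF \<beta>] A_valuationsD(1)[OF \<gamma>]])
      fix W assume "W \<in> {U. openin limit U}"
      then have W: "openin limit W" by simp
      have "\<beta> (cylinder i (core i W)) = \<gamma> (cylinder i (core i W))" if "i \<in> I" for i
        using fun_cong[OF eq[OF that], of "core i W"] q[OF core_open] by simp
      then show "\<beta> W = \<gamma> W"
        unfolding A_valuation_limit_cores[OF \<beta> W] A_valuation_limit_cores[OF \<gamma> W]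
        by (intro SUP_cong) simp_all
    qed
  next
    fix \<alpha> assume \<alpha>: "\<alpha> \<in> topspace A.limit"
    have \<alpha>_in: "\<alpha> i \<in> A_valuations (X i)" if "i \<in> I" for i
      using A.limit_coord[OF \<alpha> that] unfolding topspace_A_valuation_space .
    have "\<alpha> j (pull i j U) = \<alpha> i U" if "i \<in> I" "j \<in> I" "le i j" "openin (X i) U" for i j U
      using A.limit_compat[OF \<alpha> that(1,2,3)] A_valuation_map_apply[OF that(4), of "X j" "p i j" "\<alpha> j"]
      by simp
    from A_valuation_thread_realised[OF sober closed_threads \<alpha>_in this]
    obtain \<beta> where \<beta>: "\<beta> \<in> A_valuations limit"
      "\<forall>i\<in>I. \<forall>U. openin (X i) U \<longrightarrow> \<beta> (cylinder i U) = \<alpha> i U"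
      by blast
    have "?q i \<beta> = \<alpha> i" if "i \<in> I" for i
      by (rule extensionalityI[OF A_valuationsD(1)[OF q_in[OF that \<beta>(1)]]
            A_valuationsD(1)[OF \<alpha>_in[OF that]]]) (use \<beta>(2) that q in simp)
    then show "\<exists>\<beta>\<in>A_valuations limit. \<forall>i\<in>I. ?q i \<beta> = \<alpha> i" using \<beta>(1) by blast
  next
    fix s \<beta> assume s: "s \<in> ?S" and \<beta>: "\<beta> \<in> s"
    have \<beta>_in: "\<beta> \<in> A_valuations limit" using s \<beta> by blast
    from s consider W where "openin limit W" "s = {\<beta> \<in> A_valuations limit. \<beta> W = A1}"
      | W where "openin limit W" "s = {\<beta> \<in> A_valuations limit. \<beta> W \<noteq> A0}"
      by blast
    then show "\<exists>i\<in>I. \<exists>U. openin (A_valuation_space (X i)) U \<and> ?q i \<beta> \<in> U \<and>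
        (\<forall>\<gamma>\<in>A_valuations limit. ?q i \<gamma> \<in> U \<longrightarrow> \<gamma> \<in> s)"
    proof cases
      case 1
      note cores = A_valuation_limit_cores[OF _ 1(1)]
      obtain i where i: "i \<in> I" "\<beta> (cylinder i (core i W)) = A1"
        using \<beta> 1(2) cores[OF \<beta>_in] SUP_aval_eq_A1[of "\<lambda>i. \<beta> (cylinder i (core i W))" I] by auto
      let ?U = "{\<alpha> \<in> A_valuations (X i). \<alpha> (core i W) = A1}"
      have "\<gamma> \<in> s" if \<gamma>: "\<gamma> \<in> A_valuations limit" "?q i \<gamma> \<in> ?U" for \<gamma>
        using \<gamma> i(1) cores[OF \<gamma>(1)] SUP_aval_eq_A1[of "\<lambda>i. \<gamma> (cylinder i (core i W))" I]
        unfolding 1(2) by (auto simp: q[OF core_open])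
      moreover have "?q i \<beta> \<in> ?U" using q_in[OF i(1) \<beta>_in] i(2) q[OF core_open] by simp
      ultimately show ?thesis using i(1) openin_A_valuation_space(1)[OF core_open] by blast
    next
      case 2
      note cores = A_valuation_limit_cores[OF _ 2(1)]
      obtain i where i: "i \<in> I" "\<beta> (cylinder i (core i W)) \<noteq> A0"
        using \<beta> 2(2) cores[OF \<beta>_in] SUP_aval_eq_A0[of "\<lambda>i. \<beta> (cylinder i (core i W))" I] by auto
      let ?U = "{\<alpha> \<in> A_valuations (X i). \<alpha> (core i W) \<noteq> A0}"
      have "\<gamma> \<in> s" if \<gamma>: "\<gamma> \<in> A_valuations limit" "?q i \<gamma> \<in> ?U" for \<gamma>
        using \<gamma> i(1) cores[OF \<gamma>(1)] SUP_aval_eq_A0[of "\<lambda>i. \<gamma> (cylinder i (core i W))" I]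
        unfolding 2(2) by (auto simp: q[OF core_open])
      moreover have "?q i \<beta> \<in> ?U" using q_in[OF i(1) \<beta>_in] i(2) q[OF core_open] by simp
      ultimately show ?thesis using i(1) openin_A_valuation_space(2)[OF core_open] by blast
    qed
  qed
qed

end

section \<open>Transport along natural homeomorphisms\<close>

lemma continuous_map_via_homeomorphic_map:
  assumes hom: "homeomorphic_map A B \<phi>" and g: "g \<in> topspace Z \<rightarrow> topspace A"
    and cont: "continuous_map Z B (\<lambda>z. \<phi> (g z))"
  shows "continuous_map Z A g"
proof -
  obtain \<psi> where \<psi>: "homeomorphic_maps A B \<phi> \<psi>" using hom unfolding homeomorphic_map_maps by blast
  then have "continuous_map Z A (\<psi> \<circ> (\<lambda>z. \<phi> (g z)))"
    unfolding homeomorphic_maps_def using continuous_map_compose[OF cont] by blast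
  then show ?thesis
    by (rule continuous_map_eq) (use \<psi> g in \<open>auto simp: homeomorphic_maps_def\<close>)
qed

text \<open>Continuity and functoriality of the maps \<open>a i j\<close> and \<open>q i\<close> follow from naturality, because the
  maps \<open>\<phi> i\<close> are injective and embed the spaces \<open>A i\<close>.\<close>

lemma is_projective_limit_transport:
  assumes lim: "is_projective_limit I le B b Y' q'"
    and \<phi>: "\<And>i. i \<in> I \<Longrightarrow> homeomorphic_map (A i) (B i) (\<phi> i)"
    and \<psi>: "homeomorphic_map Y Y' \<psi>"
    and a_in: "\<And>i j x. \<lbrakk>i \<in> I; j \<in> I; le i j; x \<in> topspace (A j)\<rbrakk> \<Longrightarrow> a i j x \<in> topspace (A i)"
    and q_in: "\<And>i y. \<lbrakk>i \<in> I; y \<in> topspace Y\<rbrakk> \<Longrightarrow> q i y \<in> topspace (A i)"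
    and a_natural: "\<And>i j x. \<lbrakk>i \<in> I; j \<in> I; le i j; x \<in> topspace (A j)\<rbrakk>
      \<Longrightarrow> \<phi> i (a i j x) = b i j (\<phi> j x)"
    and q_natural: "\<And>i y. \<lbrakk>i \<in> I; y \<in> topspace Y\<rbrakk> \<Longrightarrow> \<phi> i (q i y) = q' i (\<psi> y)"
  shows "is_projective_limit I le A a Y q"
proof -
  interpret B: projective_system I le B b using lim unfolding is_projective_limit_def by blast
  have hom': "homeomorphic_map Y' B.limit (\<lambda>y. \<lambda>i\<in>I. q' i y)"
    using lim unfolding is_projective_limit_def by blast
  have \<phi>_cont: "continuous_map (A i) (B i) (\<phi> i)" if "i \<in> I" for i
    by (rule homeomorphic_imp_continuous_map[OF \<phi>[OF that]])
  have \<phi>_in: "\<phi> i x \<in> topspace (B i)" if "i \<in> I" "x \<in> topspace (A i)" for i x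
    by (rule funcset_mem[OF continuous_map_funspace[OF \<phi>_cont[OF that(1)]] that(2)])
  have \<phi>_inj: "x = y" if "i \<in> I" "x \<in> topspace (A i)" "y \<in> topspace (A i)" "\<phi> i x = \<phi> i y" for i x y
    by (rule inj_onD[OF homeomorphic_imp_injective_map[OF \<phi>[OF that(1)]] that(4,2,3)])
  interpret A: projective_system I le A a
  proof
    show "reflp_on I le" "transp_on I le" "I \<noteq> {}"
      by (rule B.index_refl B.index_trans B.index_nonempty)+
    show "\<exists>k\<in>I. le i k \<and> le j k" if "i \<in> I" "j \<in> I" for i j by (rule B.index_directed[OF that])
    show "continuous_map (A j) (A i) (a i j)" if ij: "i \<in> I" "j \<in> I" "le i j" for i j
    proof (rule continuous_map_via_homeomorphic_map[OF \<phi>[OF ij(1)]])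
      show "a i j \<in> topspace (A j) \<rightarrow> topspace (A i)" using a_in[OF ij] by blast
      have "continuous_map (A j) (B i) (b i j \<circ> \<phi> j)"
        by (rule continuous_map_compose[OF \<phi>_cont[OF ij(2)] B.bonding_continuous[OF ij]])
      then show "continuous_map (A j) (B i) (\<lambda>x. \<phi> i (a i j x))"
        by (rule continuous_map_eq) (simp add: a_natural[OF ij])
    qed
    show "a i i x = x" if x: "i \<in> I" "x \<in> topspace (A i)" for i x
    proof (rule \<phi>_inj[OF x(1) a_in[OF x(1,1) B.le_refl[OF x(1)] x(2)] x(2)])
      show "\<phi> i (a i i x) = \<phi> i x"
        unfolding a_natural[OF x(1,1) B.le_refl[OF x(1)] x(2)]
        by (rule B.bonding_id[OF x(1) \<phi>_in[OF x]])
    qed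
    fix i j k x
    assume ijk: "i \<in> I" "j \<in> I" "k \<in> I" "le i j" "le j k" and x: "x \<in> topspace (A k)"
    have ik: "le i k" by (rule B.le_trans[OF ijk])
    have jx: "a j k x \<in> topspace (A j)" by (rule a_in[OF ijk(2,3,5) x])
    show "a i j (a j k x) = a i k x"
    proof (rule \<phi>_inj[OF ijk(1) a_in[OF ijk(1,2,4) jx] a_in[OF ijk(1,3) ik x]])
      show "\<phi> i (a i j (a j k x)) = \<phi> i (a i k x)"
        unfolding a_natural[OF ijk(1,2,4) jx] a_natural[OF ijk(2,3,5) x] a_natural[OF ijk(1,3) ik x]
        by (rule B.bonding_comp[OF ijk \<phi>_in[OF ijk(3) x]])
    qed
  qed
  let ?h = "\<lambda>y. \<lambda>i\<in>I. q i y" and ?h' = "\<lambda>y. \<lambda>i\<in>I. q' i y"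
  let ?\<Psi> = "\<lambda>x. \<lambda>i\<in>I. \<phi> i (x i)"
  have \<psi>_cont: "continuous_map Y Y' \<psi>" by (rule homeomorphic_imp_continuous_map[OF \<psi>])
  have h'_cont: "continuous_map Y' B.limit ?h'" by (rule homeomorphic_imp_continuous_map[OF hom'])
  have q'_cont: "continuous_map Y' (B i) (q' i)" if i: "i \<in> I" for i
  proof -
    have "continuous_map Y' (B i) ((\<lambda>x. x i) \<circ> ?h')"
      by (rule continuous_map_compose[OF h'_cont B.continuous_map_coord[OF i]])
    then show ?thesis by (rule continuous_map_eq) (simp add: i)
  qed
  have q_compat: "a i j (q j y) = q i y" if ij: "i \<in> I" "j \<in> I" "le i j" and y: "y \<in> topspace Y" for i j y
  proof (rule \<phi>_inj[OF ij(1) a_in[OF ij q_in[OF ij(2) y]] q_in[OF ij(1) y]])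
    have "?h' (\<psi> y) \<in> topspace B.limit"
      by (rule funcset_mem[OF continuous_map_funspace[OF h'_cont]
            funcset_mem[OF continuous_map_funspace[OF \<psi>_cont] y]])
    from B.limit_compat[OF this ij]
    show "\<phi> i (a i j (q j y)) = \<phi> i (q i y)"
      using ij by (simp add: a_natural[OF ij q_in[OF ij(2) y]] q_natural y)
  qed
  have h: "continuous_map Y A.limit ?h"
  proof (rule A.continuous_map_into_limit[OF _ q_compat])
    show "continuous_map Y (A i) (q i)" if i: "i \<in> I" for i
    proof (rule continuous_map_via_homeomorphic_map[OF \<phi>[OF i]])
      show "q i \<in> topspace Y \<rightarrow> topspace (A i)" using q_in[OF i] by blast
      have "continuous_map Y (B i) (q' i \<circ> \<psi>)"
        by (rule continuous_map_compose[OF \<psi>_cont q'_cont[OF i]])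
      then show "continuous_map Y (B i) (\<lambda>y. \<phi> i (q i y))"
        by (rule continuous_map_eq) (simp add: q_natural[OF i])
    qed
  qed
  have \<Psi>: "continuous_map A.limit B.limit ?\<Psi>"
  proof (rule B.continuous_map_into_limit)
    show "continuous_map A.limit (B i) (\<lambda>x. \<phi> i (x i))" if i: "i \<in> I" for i
      using continuous_map_compose[OF A.continuous_map_coord[OF i] \<phi>_cont[OF i]]
      by (simp add: comp_def)
    show "b i j (\<phi> j (x j)) = \<phi> i (x i)"
      if ij: "i \<in> I" "j \<in> I" "le i j" and x: "x \<in> topspace A.limit" for i j x
      using a_natural[OF ij A.limit_coord[OF x ij(2)]] A.limit_compat[OF x ij] by simp
  qed
  have \<Psi>_inj: "x = y" if xy: "x \<in> topspace A.limit" "y \<in> topspace A.limit" "?\<Psi> x = ?\<Psi> y" for x y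
  proof (rule A.limit_eqI[OF xy(1,2)])
    fix i assume i: "i \<in> I"
    have "\<phi> i (x i) = \<phi> i (y i)" using fun_cong[OF xy(3), of i] i by simp
    then show "x i = y i" by (rule \<phi>_inj[OF i A.limit_coord[OF xy(1) i] A.limit_coord[OF xy(2) i]])
  qed
  \<comment> \<open>The inverse of the comparison map goes through the limit of the other system.\<close>
  have "homeomorphic_map Y B.limit (?h' \<circ> \<psi>)" by (rule homeomorphic_map_compose[OF \<psi> hom'])
  then obtain g where g: "homeomorphic_maps Y B.limit (?h' \<circ> \<psi>) g"
    unfolding homeomorphic_map_maps by blast
  have square: "?\<Psi> (?h y) = (?h' \<circ> \<psi>) y" if "y \<in> topspace Y" for y
    using q_natural that by (auto simp: fun_eq_iff)
  have gY: "g x \<in> topspace Y" if "x \<in> topspace B.limit" for x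
    using g that continuous_map_funspace unfolding homeomorphic_maps_def by blast
  have \<Psi>_in: "?\<Psi> x \<in> topspace B.limit" if "x \<in> topspace A.limit" for x
    by (rule funcset_mem[OF continuous_map_funspace[OF \<Psi>] that])
  have h_in: "?h y \<in> topspace A.limit" if "y \<in> topspace Y" for y
    by (rule funcset_mem[OF continuous_map_funspace[OF h] that])
  have "homeomorphic_maps Y A.limit ?h (g \<circ> ?\<Psi>)"
    unfolding homeomorphic_maps_def
  proof (intro conjI ballI)
    show "continuous_map Y A.limit ?h" by (rule h)
    show "continuous_map A.limit Y (g \<circ> ?\<Psi>)"
      using g continuous_map_compose[OF \<Psi>] unfolding homeomorphic_maps_def by blast
    show "(g \<circ> ?\<Psi>) (?h y) = y" if y: "y \<in> topspace Y" for y
      unfolding comp_apply[of g] square[OF y] using g y unfolding homeomorphic_maps_def by blast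
    show "?h ((g \<circ> ?\<Psi>) x) = x" if x: "x \<in> topspace A.limit" for x
    proof -
      have gx: "g (?\<Psi> x) \<in> topspace Y" by (rule gY[OF \<Psi>_in[OF x]])
      have "?\<Psi> (?h (g (?\<Psi> x))) = ?\<Psi> x"
        unfolding square[OF gx] using g \<Psi>_in[OF x] unfolding homeomorphic_maps_def by blast
      from \<Psi>_inj[OF h_in[OF gx] x this] show ?thesis by (simp only: comp_apply)
    qed
  qed
  then show ?thesis
    unfolding is_projective_limit_def homeomorphic_map_maps
    using A.projective_system_axioms by blast
qed

section \<open>Projective limits of quasi-lens spaces and of spaces of A-valuations\<close>

theorem corollary8p11:
  fixes I :: "'i set"
    and le :: "'i \<Rightarrow> 'i \<Rightarrow> bool"
    and X :: "'i \<Rightarrow> 'a topology"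
    and p :: "'i \<Rightarrow> 'i \<Rightarrow> 'a \<Rightarrow> 'a"
  assumes system: "projective_system I le X p"
    and sober: "\<And>i. i \<in> I \<Longrightarrow> sober_space (X i)"
    and cases:
      "(\<forall>i\<in>I. \<forall>j\<in>I. le i j \<longrightarrow> sat_proper_map (X j) (X i) (p i j)) \<or>
       (has_countable_cofinal_subset I le \<and> (\<forall>i\<in>I. base_locally_compact_space (X i)))"
  shows
    "is_projective_limit I le
       (\<lambda>i. quasi_lens_space (X i))
       (\<lambda>i j. quasi_lens_map (X i) (p i j))
       (quasi_lens_space (canonical_limit I le X p))
       (\<lambda>i. quasi_lens_map (X i) (\<lambda>x. x i))
     \<and>
     is_projective_limit I le
       (\<lambda>i. A_valuation_space (X i))
       (\<lambda>i j. A_valuation_map (X j) (X i) (p i j))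
       (A_valuation_space (canonical_limit I le X p))
       (\<lambda>i. A_valuation_map (canonical_limit I le X p) (X i) (\<lambda>x. x i))"
proof -
  interpret projective_system I le X p by (rule system)
  have "\<exists>x\<in>topspace limit. x i \<in> U \<and> (\<forall>j\<in>I. x j \<in> C j)"
    if C: "closed_system C" "i \<in> I" "openin (X i) U" "C i \<inter> U \<noteq> {}" for C i U
    using cases
  proof
    assume proper: "\<forall>i\<in>I. \<forall>j\<in>I. le i j \<longrightarrow> sat_proper_map (X j) (X i) (p i j)"
    show ?thesis
      by (rule closed_system_thread_proper[OF sober C(1) _ C(2,3,4)]) (use proper in blast)+
  next
    assume lc: "has_countable_cofinal_subset I le \<and> (\<forall>i\<in>I. base_locally_compact_space (X i))"
    show ?thesis
      by (rule closed_system_thread_locally_compact[OF sober C(1) _ _ C(2,3,4)]) (use lc in blast)+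
  qed
  from A_valuation_limit[OF sober this]
  have A: "is_projective_limit I le (\<lambda>i. A_valuation_space (X i))
    (\<lambda>i j. A_valuation_map (X j) (X i) (p i j)) (A_valuation_space limit)
    (\<lambda>i. A_valuation_map limit (X i) (\<lambda>x. x i))" .
  have "is_projective_limit I le (\<lambda>i. quasi_lens_space (X i)) (\<lambda>i j. quasi_lens_map (X i) (p i j))
    (quasi_lens_space limit) (\<lambda>i. quasi_lens_map (X i) (\<lambda>x. x i))"
  proof (rule is_projective_limit_transport[OF A, where \<phi> = "\<lambda>i. lens_valuation (X i)"
        and \<psi> = "lens_valuation limit"], unfold topspace_quasi_lens_space)
    show "homeomorphic_map (quasi_lens_space (X i)) (A_valuation_space (X i)) (lens_valuation (X i))"
      if "i \<in> I" for i
      by (rule homeomorphic_map_lens_valuation[OF sober[OF that]])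
    show "homeomorphic_map (quasi_lens_space limit) (A_valuation_space limit) (lens_valuation limit)"
      by (rule homeomorphic_map_lens_valuation[OF sober_limit[OF sober]])
  next
    fix i j L assume "i \<in> I" "j \<in> I" "le i j" and L: "L \<in> quasi_lenses (X j)"
    note f = bonding_continuous[OF this(1,2,3)]
    obtain Q C where "L = (Q, C)" by (cases L)
    then show "quasi_lens_map (X i) (p i j) L \<in> quasi_lenses (X i)"
      "lens_valuation (X i) (quasi_lens_map (X i) (p i j) L) =
        A_valuation_map (X j) (X i) (p i j) (lens_valuation (X j) L)"
      using quasi_lens_map_natural[OF f] L by simp_all
  next
    fix i L assume i: "i \<in> I" and L: "L \<in> quasi_lenses limit"
    obtain Q C where "L = (Q, C)" by (cases L)
    then show "quasi_lens_map (X i) (\<lambda>x. x i) L \<in> quasi_lenses (X i)"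
      "lens_valuation (X i) (quasi_lens_map (X i) (\<lambda>x. x i) L) =
        A_valuation_map limit (X i) (\<lambda>x. x i) (lens_valuation limit L)"
      using quasi_lens_map_natural[OF continuous_map_coord[OF i]] L by simp_all
  qed
  then show ?thesis using A by blast
qed

end
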